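(* Let $0<\theta<1$, $1<r<\infty$, $1<p<q<\infty$, $\alpha>0$, and let $\frac{1}{p_\theta}=\frac{1-\theta}{p}+\frac{\theta}{q}$. Then $$\bigl(L^{(p,\alpha}(\Omega),L^{(q,\alpha}(\Omega)\bigr)_{\theta,r}=L^{p_\theta,r}(\log L)^{\frac{\alpha}{p'_\theta}},\qquad\text{where }\tfrac1{p_\theta}+\tfrac1{p'_\theta}=1,$$ with equivalent norms.
   Context: $\Omega\subset\mathbb R^n$ is a bounded open set with $|\Omega|=1$; $f_*$ is the decreasing rearrangement of $|f|$ on $(0,1)$; $\log$ is the natural logarithm. Small Lebesgue space: for $1<p<\infty$, $\alpha>0$, $L^{(p,\alpha}(\Omega)$ is the set of measurable $f$ with $$\|f\|_{(p,\alpha}=\int_0^1(1-\log t)^{-\frac{\alpha}{p}+\alpha-1}\Bigl(\int_0^t f_*^p(\sigma)d\sigma\Bigr)^{1/p}\frac{dt}{t}<\infty.$$ Lorentz–Zygmund space: $L^{a,r}(\log L)^{\beta}$ is the set of measurable $f$ with $\|f\|_{a,r;\beta}=\bigl(\int_0^1[t^{1/a}(1-\log t)^{\beta}f_*(t)]^r\frac{dt}{t}\bigr)^{1/r}<\infty$. K-functional: $K(g,t;X_0,X_1)=\inf_{g=g_0+g_1}(\|g_0\|_{X_0}+t\|g_1\|_{X_1})$; $(X_0,X_1)_{\theta,r}$ is the set of $g\in X_0+X_1$ with $\bigl(\int_0^1[t^{-\theta}K(g,t)]^r\frac{dt}{t}\bigr)^{1/r}<\infty$ (only $t\in(0,1)$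 used). *)

theory Defs
  imports "HOL-Analysis.Analysis"
begin

definition rearr :: "'a::euclidean_space set \<Rightarrow> ('a \<Rightarrow> real) \<Rightarrow> real \<Rightarrow> real" where
  "rearr \<Omega> f t = Inf {s::real. 0 \<le> s \<and> emeasure lebesgue {x\<in>\<Omega>. s < \<bar>f x\<bar>} \<le> ennreal t}"

text \<open>Real power of an extended nonnegative real (exponent a > 0).\<close>
definition epow :: "ennreal \<Rightarrow> real \<Rightarrow> ennreal" where
  "epow x a = (if x = top then top else ennreal (enn2real x powr a))"

definition meas_on :: "'a::euclidean_space set \<Rightarrow> ('a \<Rightarrow> real) \<Rightarrow> bool" where
  "meas_on \<Omega> f \<longleftrightarrow> set_borel_measurable lebesgue \<Omega> f"

definition small_leb_norm :: "'a::euclidean_space set \<Rightarrow> real \<Rightarrow> real \<Rightarrow> ('a \<Rightarrow> real) \<Rightarrow> ennreal" where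
  "small_leb_norm \<Omega> p \<alpha> f =
     (\<integral>\<^sup>+ t \<in> {0<..<1}.
        ennreal ((1 - ln t) powr (- \<alpha> / p + \<alpha> - 1)) *
        epow (\<integral>\<^sup>+ \<sigma> \<in> {0<..<t}. ennreal (rearr \<Omega> f \<sigma> powr p) \<partial>lborel) (1 / p) *
        ennreal (1 / t) \<partial>lborel)"

definition small_leb :: "'a::euclidean_space set \<Rightarrow> real \<Rightarrow> real \<Rightarrow> ('a \<Rightarrow> real) set" where
  "small_leb \<Omega> p \<alpha> = {f. meas_on \<Omega> f \<and> small_leb_norm \<Omega> p \<alpha> f < top}"

definition lz_norm :: "'a::euclidean_space set \<Rightarrow> real \<Rightarrow> real \<Rightarrow> real \<Rightarrow> ('a \<Rightarrow> real) \<Rightarrow> ennreal" where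
  "lz_norm \<Omega> a r \<beta> f =
     epow (\<integral>\<^sup>+ t \<in> {0<..<1}.
        ennreal ((t powr (1 / a) * (1 - ln t) powr \<beta> * rearr \<Omega> f t) powr r * (1 / t)) \<partial>lborel)
      (1 / r)"

definition lz_space :: "'a::euclidean_space set \<Rightarrow> real \<Rightarrow> real \<Rightarrow> real \<Rightarrow> ('a \<Rightarrow> real) set" where
  "lz_space \<Omega> a r \<beta> = {f. meas_on \<Omega> f \<and> lz_norm \<Omega> a r \<beta> f < top}"

definition Kfun :: "'a set \<Rightarrow> ('a \<Rightarrow> real) set \<Rightarrow> (('a \<Rightarrow> real) \<Rightarrow> ennreal)
    \<Rightarrow> ('a \<Rightarrow> real) set \<Rightarrow> (('a \<Rightarrow> real) \<Rightarrow> ennreal) \<Rightarrow> ('a \<Rightarrow> real) \<Rightarrow> real \<Rightarrow> ennreal" where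
  "Kfun \<Omega> X0 N0 X1 N1 g t =
     (INF (g0, g1) \<in> {(g0, g1). g0 \<in> X0 \<and> g1 \<in> X1 \<and> (\<forall>x\<in>\<Omega>. g x = g0 x + g1 x)}.
        N0 g0 + ennreal t * N1 g1)"

definition sum_space :: "'a set \<Rightarrow> ('a \<Rightarrow> real) set \<Rightarrow> ('a \<Rightarrow> real) set \<Rightarrow> ('a \<Rightarrow> real) set" where
  "sum_space \<Omega> X0 X1 = {g. \<exists>g0\<in>X0. \<exists>g1\<in>X1. \<forall>x\<in>\<Omega>. g x = g0 x + g1 x}"

definition interp_norm :: "'a set \<Rightarrow> ('a \<Rightarrow> real) set \<Rightarrow> (('a \<Rightarrow> real) \<Rightarrow> ennreal)
    \<Rightarrow> ('a \<Rightarrow> real) set \<Rightarrow> (('a \<Rightarrow> real) \<Rightarrow> ennreal) \<Rightarrow> real \<Rightarrow> real \<Rightarrow> ('a \<Rightarrow> real) \<Rightarrow> ennreal" where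
  "interp_norm \<Omega> X0 N0 X1 N1 \<theta> r g =
     epow (\<integral>\<^sup>+ t \<in> {0<..<1}.
        epow (ennreal (t powr (- \<theta>)) * Kfun \<Omega> X0 N0 X1 N1 g t) r * ennreal (1 / t) \<partial>lborel) (1 / r)"

definition interp_space :: "'a set \<Rightarrow> ('a \<Rightarrow> real) set \<Rightarrow> (('a \<Rightarrow> real) \<Rightarrow> ennreal)
    \<Rightarrow> ('a \<Rightarrow> real) set \<Rightarrow> (('a \<Rightarrow> real) \<Rightarrow> ennreal) \<Rightarrow> real \<Rightarrow> real \<Rightarrow> ('a \<Rightarrow> real) set" where
  "interp_space \<Omega> X0 N0 X1 N1 \<theta> r =
     {g \<in> sum_space \<Omega> X0 X1. interp_norm \<Omega> X0 N0 X1 N1 \<theta> r g < top}"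

end

(*
  With l(u) = 1 - ln u and phi_x(u) = u^x l(u)^(alpha (1 - x)), the norm of L^((p,alpha) is bounded below
  by the weak norm sup phi_{1/p}(u) f*(u) and above by the Lorentz norm int phi_{1/p}(s) f*(s) ds/s.
  The lower bound, applied to the summands of g = g0 + g1 with g*(2u) <= g0*(u) + g1*(u), and the upper
  bound, applied to the truncation of g at height g*(u), estimate K(g,t) at the point
  t = rho(u) = phi_{1/p}(u) / phi_{1/q}(u) from both sides. The two estimates differ by a Hardy operator
  with kernel min(s/u, u/s)^b on (0,1) with the measure ds/s, which is bounded on L^r by Schur's test.
  Since u rho'(u) / rho(u) = (1/p - 1/q) (1 + alpha / l(u)) lies between positive constants,
  dt/t may be replaced by du/u, and phi_{1/p} rho^(-theta) is the weight of the Lorentz-Zygmund space.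
*)
theory Submission
  imports Defs
begin

section \<open>Integration with respect to \<open>dt / t\<close>\<close>

text \<open>The weak and the Lorentz norm that enclose a small Lebesgue norm are in general not
  equivalent. Interpolation closes the gap because 0 < theta < 1 leaves a positive power of rho to
  spare on each side of the point u. The weights fit together because both exponents of phi, namely
  x and alpha (1 - x), are affine in x with the same alpha at both endpoints. They form a geometric
  family, so the factor t^(-theta) at t = rho(u) carries the first endpoint weight exactly to the
  one at x = 1/p_theta. Its logarithmic exponent alpha (1 - 1/p_theta) is alpha / p_theta', which
  explains the conjugate exponent in the result. Since rho(1) = 1, the range 0 < t < 1 of the
  interpolation norm corresponds exactly to 0 < u < 1, where the rearrangement of a function on a
  set of measure 1 lives, so no boundary term arises. All norms take values in [0, top], so each
  inequality also transports finiteness; for the equality of the spaces only measurability and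
  membership in the sum space remain.\<close>

lemma epow_mono: "0 \<le> a \<Longrightarrow> x \<le> y \<Longrightarrow> epow x a \<le> epow y a"
  by (auto simp: epow_def top_unique intro!: ennreal_leI powr_mono2 enn2real_mono simp: less_top)

lemma epow_ennreal: "0 \<le> x \<Longrightarrow> epow (ennreal x) a = ennreal (x powr a)"
  by (simp add: epow_def)

lemma epow_top [simp]: "epow top a = top"
  by (simp add: epow_def)

lemma epow_0 [simp]: "epow 0 a = 0"
  by (simp add: epow_def)

lemma epow_eq_top_iff [simp]: "epow x a = top \<longleftrightarrow> x = top"
  by (simp add: epow_def)

lemma epow_eq_0_iff [simp]: "epow x a = 0 \<longleftrightarrow> x = 0"
  by (cases x) (auto simp: epow_def)

lemma epow_mult: "epow (x * y) a = epow x a * epow y a"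
proof (cases "x = 0 \<or> y = 0 \<or> x = top \<or> y = top")
  case True
  then show ?thesis
    by (auto simp: ennreal_mult_top ennreal_top_mult)
next
  case False
  then obtain x' y' where "x = ennreal x'" "y = ennreal y'" "0 \<le> x'" "0 \<le> y'"
    by (metis ennreal_cases)
  then show ?thesis
    by (simp add: epow_ennreal powr_mult flip: ennreal_mult)
qed

lemma epow_root_le:
  assumes "0 < r" "0 < C" "x \<le> ennreal C * y"
  shows "epow x (1 / r) \<le> ennreal (C powr (1 / r)) * epow y (1 / r)"
proof -
  have "epow x (1 / r) \<le> epow (ennreal C * y) (1 / r)"
    using assms by (intro epow_mono) auto
  also have "\<dots> = ennreal (C powr (1 / r)) * epow y (1 / r)"
    using assms by (simp add: epow_mult epow_ennreal)
  finally show ?thesis .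
qed

text \<open>Bounding the sum by twice the maximum treats convex and concave powers alike.\<close>

lemma epow_add_le:
  assumes "0 \<le> a"
  shows "epow (x + y) a \<le> ennreal (2 powr a) * (epow x a + epow y a)"
proof -
  have "epow (x + y) a \<le> epow (2 * max x y) a"
    by (intro epow_mono assms) (simp add: mult_2 add_mono)
  also have "\<dots> = ennreal (2 powr a) * epow (max x y) a"
    using epow_ennreal[of 2 a] by (simp add: epow_mult)
  also have "\<dots> \<le> ennreal (2 powr a) * (epow x a + epow y a)"
    by (intro mult_left_mono) (auto simp: max_def)
  finally show ?thesis .
qed

lemma measurable_epow [measurable]:
  assumes [measurable]: "f \<in> borel_measurable M"
  shows "(\<lambda>x. epow (f x) a) \<in> borel_measurable M"
  unfolding epow_def by measurable

text \<open>Superlevel sets of a monotone function are intervals. This is the source of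
  measurability for K(g,t), an infimum over an uncountable family, and for rearrangements.\<close>

lemma borel_measurable_mono_ennreal:
  fixes f :: "real \<Rightarrow> ennreal"
  assumes "mono f"
  shows "f \<in> borel_measurable borel"
proof (rule borel_measurableI_greater)
  fix y
  have "is_interval {x. y < f x}"
    unfolding is_interval_1 using monoD[OF assms] by (auto intro: less_le_trans)
  then show "{x \<in> space borel. y < f x} \<in> sets borel"
    by (simp add: real_interval_borel_measurable)
qed

section \<open>The measure ds/s on the unit interval\<close>

definition log_measure :: "real measure"
  where "log_measure = density lborel (\<lambda>s. ennreal (1 / s) * indicator {0<..<1} s)"

lemma sets_log_measure [simp, measurable_cong]: "sets log_measure = sets borel"
  by (simp add: log_measure_def)

lemma space_log_measure [simp]: "space log_measure = UNIV"
  by (simp add: log_measure_def)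

lemma nn_integral_log_measure:
  assumes [measurable]: "f \<in> borel_measurable borel"
  shows "(\<integral>\<^sup>+s. f s \<partial>log_measure)
       = (\<integral>\<^sup>+s\<in>{0<..<1}. f s * ennreal (1 / s) \<partial>lborel)"
  unfolding log_measure_def
  by (subst nn_integral_density) (auto intro!: nn_integral_cong simp: ac_simps)

lemma AE_log_measure: "AE s in log_measure. 0 < s \<and> s < 1"
  unfolding log_measure_def
  by (subst AE_density) (auto simp: indicator_def)

lemma nn_integral_log_measure_mono:
  assumes "\<And>s. 0 < s \<Longrightarrow> s < 1 \<Longrightarrow> f s \<le> g s"
  shows "(\<integral>\<^sup>+s. f s \<partial>log_measure) \<le> (\<integral>\<^sup>+s. g s \<partial>log_measure)"
  by (rule nn_integral_mono_AE) (use AE_log_measure assms in \<open>auto elim: eventually_mono\<close>)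

text \<open>The total mass is infinite, so exchanging integrals in Schur's test rests on
  sigma-finiteness.\<close>

lemma sigma_finite_log_measure: "sigma_finite_measure log_measure"
  unfolding log_measure_def
  by (subst sigma_finite_measure.sigma_finite_iff_density_finite[OF lborel.sigma_finite_measure_axioms]) (auto simp: indicator_def)

lemma nn_integral_powr_from_0:
  assumes "0 < b" "0 \<le> u"
  shows "(\<integral>\<^sup>+s\<in>{0<..<u}. ennreal (s powr (b - 1)) \<partial>lborel) = ennreal (u powr b / b)"
proof -
  have "((\<lambda>x. x powr (b-1)) has_integral (u powr b / b)) {0<..<u}"
    using has_integral_powr_from_0[of "b - 1" u] assms by (simp add: has_integral_Icc_iff_Ioo)
  then show ?thesis
    by (intro nn_integral_has_integral_lebesgue') auto
qed

lemma nn_integral_FTC_open: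
  fixes F f :: "real \<Rightarrow> real"
  assumes "a \<le> b"
    and "\<And>x. a \<le> x \<Longrightarrow> x \<le> b \<Longrightarrow> (F has_real_derivative f x) (at x)"
    and "\<And>x. a < x \<Longrightarrow> x < b \<Longrightarrow> 0 \<le> f x"
  shows "(\<integral>\<^sup>+s\<in>{a<..<b}. ennreal (f s) \<partial>lborel) = ennreal (F b - F a)"
proof -
  have "(f has_integral (F b - F a)) {a..b}"
    by (rule fundamental_theorem_of_calculus)
       (use assms in \<open>auto intro: has_field_derivative_at_within
          simp: has_real_derivative_iff_has_vector_derivative[symmetric]\<close>)
  then have "(f has_integral (F b - F a)) {a<..<b}"
    by (simp add: has_integral_Icc_iff_Ioo)
  then show ?thesis
    using assms by (intro nn_integral_has_integral_lebesgue') auto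
qed

lemma nn_integral_log_measure_less:
  assumes "0 < b" "0 < u" "u \<le> 1"
  shows "(\<integral>\<^sup>+s. ennreal ((s / u) powr b) * indicator {..<u} s \<partial>log_measure) = ennreal (1 / b)"
proof -
  have "(\<integral>\<^sup>+s. ennreal ((s / u) powr b) * indicator {..<u} s \<partial>log_measure)
      = (\<integral>\<^sup>+s. ennreal (u powr - b) * (ennreal (s powr (b - 1)) * indicator {0<..<u} s) \<partial>lborel)"
    using assms
    by (subst nn_integral_log_measure)
       (auto intro!: nn_integral_cong simp: indicator_def powr_divide powr_diff powr_minus divide_simps
         simp flip: ennreal_mult split: if_splits)
  also have "\<dots> = ennreal (u powr - b) * ennreal (u powr b / b)"
    using assms by (subst nn_integral_cmult) (auto simp: nn_integral_powr_from_0)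
  also have "\<dots> = ennreal (1 / b)"
    using assms by (auto simp: powr_minus field_simps simp flip: ennreal_mult)
  finally show ?thesis .
qed

text \<open>The integral stops at 1 instead of running to infinity, so its value is (1 - u^b) / b.
  What matters is a bound uniform in u.\<close>

lemma nn_integral_log_measure_greater:
  assumes "0 < b" "0 < u" "u \<le> 1"
  shows "(\<integral>\<^sup>+s. ennreal ((u / s) powr b) * indicator {u<..} s \<partial>log_measure) \<le> ennreal (1 / b)"
proof -
  have "(\<integral>\<^sup>+s. ennreal ((u / s) powr b) * indicator {u<..} s \<partial>log_measure)
      = (\<integral>\<^sup>+s\<in>{u<..<1}. ennreal (u powr b * s powr (- b - 1)) \<partial>lborel)"
    using assms
    by (subst nn_integral_log_measure)
       (auto intro!: nn_integral_cong simp: indicator_def powr_divide powr_diff powr_minus divide_simps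
         simp flip: ennreal_mult split: if_splits)
  also have "\<dots> = ennreal ((- (u powr b) / b * 1 powr (- b)) - (- (u powr b) / b * u powr (- b)))"
  proof (rule nn_integral_FTC_open)
    show "((\<lambda>x. - (u powr b) / b * x powr - b) has_real_derivative u powr b * x powr (- b - 1)) (at x)"
      if "u \<le> x" "x \<le> 1" for x
      using that assms by (auto intro!: derivative_eq_intros)
  qed (use assms in auto)
  also have "\<dots> \<le> ennreal (1 / b)"
    using assms by (auto intro!: ennreal_leI simp: powr_minus field_simps)
  finally show ?thesis .
qed

section \<open>Rearrangements\<close>

locale unit_domain =
  fixes \<Omega> :: "'a::euclidean_space set"
  assumes sets_domain [measurable]: "\<Omega> \<in> sets lebesgue"
    and emeasure_domain: "emeasure lebesgue \<Omega> = 1"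
begin

lemma meas_on_iff: "meas_on \<Omega> f \<longleftrightarrow> (\<lambda>x. indicator \<Omega> x * f x) \<in> borel_measurable lebesgue"
  by (simp add: meas_on_def set_borel_measurable_def)

lemma sets_level:
  assumes "meas_on \<Omega> f"
  shows "{x\<in>\<Omega>. s < \<bar>f x\<bar>} \<in> sets lebesgue"
proof -
  have [measurable]: "(\<lambda>x. indicator \<Omega> x * f x) \<in> borel_measurable lebesgue"
    using assms by (simp add: meas_on_iff)
  have "{x\<in>\<Omega>. s < \<bar>f x\<bar>} = \<Omega> \<inter> {x\<in>space lebesgue. s < \<bar>indicator \<Omega> x * f x\<bar>}"
    by auto
  also have "\<dots> \<in> sets lebesgue"
    by measurable
  finally show ?thesis .
qed

text \<open>The level sets shrink to the empty set inside a set of finite measure, so their measures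
  tend to 0. Hence for t > 0 the infimum defining \<open>rearr\<close> runs over a nonempty
  set.\<close>

lemma exists_small_level:
  assumes "meas_on \<Omega> f" "0 < t"
  shows "\<exists>s\<ge>0. emeasure lebesgue {x\<in>\<Omega>. s < \<bar>f x\<bar>} \<le> ennreal t"
proof -
  let ?A = "\<lambda>n::nat. {x\<in>\<Omega>. real n < \<bar>f x\<bar>}"
  have "emeasure lebesgue (?A n) \<noteq> \<infinity>" for n
  proof -
    have "emeasure lebesgue (?A n) \<le> emeasure lebesgue \<Omega>"
      by (intro emeasure_mono) (auto simp: sets_domain)
    then show ?thesis
      by (auto simp: emeasure_domain top_unique)
  qed
  then have "(\<lambda>n. emeasure lebesgue (?A n)) \<longlonglongrightarrow> emeasure lebesgue (\<Inter>n. ?A n)"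
    using assms by (intro Lim_emeasure_decseq) (auto simp: sets_level decseq_def)
  moreover have "(\<Inter>n. ?A n) = {}"
    by (auto simp: not_less) (meson not_less real_arch_simple)
  ultimately have "(\<lambda>n. emeasure lebesgue (?A n)) \<longlonglongrightarrow> 0"
    by simp
  then have "\<forall>\<^sub>F n in sequentially. emeasure lebesgue (?A n) < ennreal t"
    using assms by (auto dest!: order_tendstoD(2)[of _ _ _ "ennreal t"])
  then obtain n where "emeasure lebesgue (?A n) < ennreal t"
    by (auto simp: eventually_sequentially)
  then show ?thesis
    by (intro exI[of _ "real n"]) auto
qed

lemma rearr_nonneg:
  assumes "meas_on \<Omega> f" "0 < t"
  shows "0 \<le> rearr \<Omega> f t"
  unfolding rearr_def using exists_small_level[OF assms] by (intro cInf_greatest) auto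

text \<open>The distribution function is right continuous, so the infimum is attained and
  rearrangement and distribution function form a Galois connection. The other facts about
  \<open>rearr\<close> are read off from this equivalence.\<close>

lemma rearr_le_iff:
  assumes f: "meas_on \<Omega> f" and t: "0 < t" and s: "0 \<le> s"
  shows "rearr \<Omega> f t \<le> s \<longleftrightarrow> emeasure lebesgue {x\<in>\<Omega>. s < \<bar>f x\<bar>} \<le> ennreal t"
proof
  assume "emeasure lebesgue {x\<in>\<Omega>. s < \<bar>f x\<bar>} \<le> ennreal t"
  then show "rearr \<Omega> f t \<le> s"
    unfolding rearr_def using s by (intro cInf_lower bdd_belowI[of _ 0]) auto
next
  assume le: "rearr \<Omega> f t \<le> s"
  \<comment> \<open>These sets increase to the level set at s, and each lies in a level set of some
    admissible s' below s + 1/(n+1); continuity of the measure from below then gives the bound at s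
    itself.\<close>
  let ?A = "\<lambda>n. {x\<in>\<Omega>. s + 1 / real (Suc n) < \<bar>f x\<bar>}"
  have "emeasure lebesgue (?A n) \<le> ennreal t" for n
  proof -
    have "Inf {s::real. 0 \<le> s \<and> emeasure lebesgue {x\<in>\<Omega>. s < \<bar>f x\<bar>} \<le> ennreal t} < s + 1 / real (Suc n)"
      using le unfolding rearr_def by (rule order.strict_trans1) simp
    then obtain s' where s': "0 \<le> s'" "emeasure lebesgue {x\<in>\<Omega>. s' < \<bar>f x\<bar>} \<le> ennreal t"
      "s' < s + 1 / real (Suc n)"
      using exists_small_level[OF f t] by (subst (asm) cInf_less_iff) (auto intro!: bdd_belowI[of _ 0])
    have "emeasure lebesgue (?A n) \<le> emeasure lebesgue {x\<in>\<Omega>. s' < \<bar>f x\<bar>}"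
      using s' f by (intro emeasure_mono sets_level) auto
    with s' show ?thesis by auto
  qed
  then have "(SUP n. emeasure lebesgue (?A n)) \<le> ennreal t"
    by (intro SUP_least)
  moreover have "(SUP n. emeasure lebesgue (?A n)) = emeasure lebesgue (\<Union>n. ?A n)"
  proof (intro SUP_emeasure_incseq incseq_SucI subsetI)
    fix n x assume x: "x \<in> ?A n"
    have "1 / real (Suc (Suc n)) \<le> 1 / real (Suc n)"
      by (simp add: divide_simps)
    with x show "x \<in> ?A (Suc n)"
      by (auto simp del: of_nat_Suc)
  qed (use f in \<open>auto simp: sets_level\<close>)
  moreover have "(\<Union>n. ?A n) = {x\<in>\<Omega>. s < \<bar>f x\<bar>}"
  proof safe
    fix x assume "s < \<bar>f x\<bar>"
    then obtain n where "1 / real (Suc n) < \<bar>f x\<bar> - s"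
      using nat_approx_posE[of "\<bar>f x\<bar> - s"] by auto
    moreover assume "x \<in> \<Omega>"
    ultimately show "x \<in> (\<Union>n. ?A n)" by (auto simp: algebra_simps)
  next
    fix x n assume "s + 1 / real (Suc n) < \<bar>f x\<bar>"
    moreover have "0 < 1 / real (Suc n)"
      by simp
    ultimately show "s < \<bar>f x\<bar>"
      by linarith
  qed
  ultimately show "emeasure lebesgue {x\<in>\<Omega>. s < \<bar>f x\<bar>} \<le> ennreal t"
    by simp
qed

lemma emeasure_level_rearr:
  assumes "meas_on \<Omega> f" "0 < t"
  shows "emeasure lebesgue {x\<in>\<Omega>. rearr \<Omega> f t < \<bar>f x\<bar>} \<le> ennreal t"
  using rearr_le_iff[OF assms rearr_nonneg[OF assms]] by simp

lemma rearr_antimono: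
  assumes "meas_on \<Omega> f" "0 < t" "t \<le> t'"
  shows "rearr \<Omega> f t' \<le> rearr \<Omega> f t"
proof -
  have "ennreal t \<le> ennreal t'"
    using assms by (intro ennreal_leI)
  then show ?thesis
    using assms emeasure_level_rearr[of f t]
    by (subst rearr_le_iff) (auto intro: rearr_nonneg order.trans)
qed

lemma rearr_mono:
  assumes "meas_on \<Omega> f" "meas_on \<Omega> g" "0 < t" "\<And>x. x \<in> \<Omega> \<Longrightarrow> \<bar>f x\<bar> \<le> \<bar>g x\<bar>"
  shows "rearr \<Omega> f t \<le> rearr \<Omega> g t"
proof -
  have "emeasure lebesgue {x\<in>\<Omega>. rearr \<Omega> g t < \<bar>f x\<bar>} \<le> emeasure lebesgue {x\<in>\<Omega>. rearr \<Omega> g t < \<bar>g x\<bar>}"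
    using assms by (intro emeasure_mono sets_level) force+
  also have "\<dots> \<le> ennreal t"
    using assms by (intro emeasure_level_rearr)
  finally show ?thesis
    using assms by (subst rearr_le_iff) (auto intro: rearr_nonneg)
qed

lemma rearr_le_bound:
  assumes "meas_on \<Omega> f" "0 < t" "0 \<le> c" "\<And>x. x \<in> \<Omega> \<Longrightarrow> \<bar>f x\<bar> \<le> c"
  shows "rearr \<Omega> f t \<le> c"
proof -
  have "{x\<in>\<Omega>. c < \<bar>f x\<bar>} = {}"
    using assms by (auto simp: not_less)
  then have "emeasure lebesgue {x\<in>\<Omega>. c < \<bar>f x\<bar>} = 0"
    by (simp only: emeasure_empty)
  then show ?thesis
    using assms(1-3) rearr_le_iff[of f t c] by simp
qed

text \<open>Where |f| exceeds the sum of the two levels, one summand exceeds its own level. Each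
  exceptional set has measure at most t, which is why the argument doubles on the left.\<close>

lemma rearr_add_le:
  assumes "meas_on \<Omega> f" "meas_on \<Omega> g0" "meas_on \<Omega> g1" "0 < t"
    and sum: "\<And>x. x \<in> \<Omega> \<Longrightarrow> f x = g0 x + g1 x"
  shows "rearr \<Omega> f (2 * t) \<le> rearr \<Omega> g0 t + rearr \<Omega> g1 t"
proof -
  let ?A = "\<lambda>g. {x\<in>\<Omega>. rearr \<Omega> g t < \<bar>g x\<bar>}"
  have "emeasure lebesgue {x\<in>\<Omega>. rearr \<Omega> g0 t + rearr \<Omega> g1 t < \<bar>f x\<bar>} \<le> emeasure lebesgue (?A g0 \<union> ?A g1)"
    using assms by (intro emeasure_mono) (auto simp: sets_level)
  also have "\<dots> \<le> emeasure lebesgue (?A g0) + emeasure lebesgue (?A g1)"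
    using assms by (intro emeasure_subadditive sets_level)
  also have "\<dots> \<le> ennreal t + ennreal t"
    using assms by (intro add_mono emeasure_level_rearr)
  also have "\<dots> = ennreal (2 * t)"
    using assms by (simp flip: ennreal_plus)
  finally show ?thesis
    using assms by (subst rearr_le_iff) (auto intro!: add_nonneg_nonneg rearr_nonneg)
qed

text \<open>Made for the unbounded part of a truncation at height g*(u): it lives where |g| > g*(u),
  a set of measure at most u.\<close>

lemma rearr_eq_0:
  assumes "meas_on \<Omega> f" "meas_on \<Omega> g" "0 < u" "u \<le> s"
    and "\<And>x. x \<in> \<Omega> \<Longrightarrow> \<bar>g x\<bar> \<le> rearr \<Omega> g u \<Longrightarrow> f x = 0"
  shows "rearr \<Omega> f s = 0"
proof -
  have "emeasure lebesgue {x\<in>\<Omega>. 0 < \<bar>f x\<bar>} \<le> emeasure lebesgue {x\<in>\<Omega>. rearr \<Omega> g u < \<bar>g x\<bar>}"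
    using assms by (intro emeasure_mono sets_level) force+
  also have "\<dots> \<le> ennreal u"
    using assms by (intro emeasure_level_rearr)
  also have "\<dots> \<le> ennreal s"
    using assms by (intro ennreal_leI)
  finally have "rearr \<Omega> f s \<le> 0"
    using assms by (subst rearr_le_iff) auto
  then show ?thesis
    using rearr_nonneg[of f s] assms by auto
qed

text \<open>Outside \<open>t > 0\<close> the value of \<^const>\<open>rearr\<close> is the infimum of a possibly empty set;
  it is cut off there to obtain a Borel function on the whole line.\<close>

definition decr :: "('a \<Rightarrow> real) \<Rightarrow> real \<Rightarrow> real"
  where "decr f t = (if 0 < t then rearr \<Omega> f t else 0)"

lemma decr_eq: "0 < t \<Longrightarrow> decr f t = rearr \<Omega> f t"
  by (simp add: decr_def)

lemma decr_nonneg: "meas_on \<Omega> f \<Longrightarrow> 0 \<le> decr f t"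
  by (simp add: decr_def rearr_nonneg)

lemma decr_antimono: "meas_on \<Omega> f \<Longrightarrow> 0 < t \<Longrightarrow> t \<le> t' \<Longrightarrow> decr f t' \<le> decr f t"
  by (simp add: decr_def rearr_antimono)

lemma measurable_decr [measurable]:
  assumes "meas_on \<Omega> f"
  shows "decr f \<in> borel_measurable borel"
proof -
  \<comment> \<open>Reflection turns the decreasing function into an increasing one. The value
    \<open>top\<close> on t \<ge> 0 keeps F monotone, and \<open>enn2real\<close> sends it to 0, the
    cut-off value of \<open>decr\<close>.\<close>
  define F where "F t = (if t < 0 then ennreal (rearr \<Omega> f (- t)) else top)" for t
  have "mono F"
    by (rule monoI) (use assms in \<open>auto simp: F_def intro!: ennreal_leI rearr_antimono\<close>)
  then have [measurable]: "F \<in> borel_measurable borel"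
    by (rule borel_measurable_mono_ennreal)
  have "decr f = (\<lambda>t. enn2real (F (- t)))"
    using assms by (auto simp: decr_def F_def rearr_nonneg)
  then show ?thesis
    by simp
qed

end

section \<open>Weights and small Lebesgue norms\<close>

definition phi :: "real \<Rightarrow> real \<Rightarrow> real \<Rightarrow> real"
  where "phi \<alpha> x s = s powr x * (1 - ln s) powr (\<alpha> * (1 - x))"

text \<open>For d = 1/p - 1/q this is the quotient of the endpoint weights. The parameter d is kept
  free because every real power of \<open>rho\<close> is again a \<open>rho\<close>.\<close>

definition rho :: "real \<Rightarrow> real \<Rightarrow> real \<Rightarrow> real"
  where "rho \<alpha> d s = s powr d * (1 - ln s) powr (- \<alpha> * d)"

lemma measurable_phi [measurable]: "phi \<alpha> x \<in> borel_measurable borel"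
  unfolding phi_def by measurable

lemma measurable_rho [measurable]: "rho \<alpha> d \<in> borel_measurable borel"
  unfolding rho_def by measurable

lemma ln_less_1: "0 < s \<Longrightarrow> s \<le> 1 \<Longrightarrow> ln (s::real) < 1"
  using ln_le_zero_iff[of s] by linarith

lemma phi_nonneg: "0 \<le> phi \<alpha> x s"
  by (simp add: phi_def)

lemma rho_pos: "0 < s \<Longrightarrow> s \<le> 1 \<Longrightarrow> 0 < rho \<alpha> d s"
  using ln_less_1[of s] by (simp add: rho_def)

text \<open>Both exponents of \<open>phi\<close> are affine in x, so a shift of x multiplies the
  weight by a factor independent of x.\<close>

lemma phi_add: "phi \<alpha> (x + d) s = rho \<alpha> d s * phi \<alpha> x s"
proof -
  have "\<alpha> * (1 - (x + d)) = - \<alpha> * d + \<alpha> * (1 - x)"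
    by (simp add: algebra_simps)
  then show ?thesis
    unfolding phi_def rho_def by (simp only: powr_add) (simp add: powr_add mult_ac)
qed

lemma rho_powr: "rho \<alpha> d s powr c = rho \<alpha> (d * c) s"
  by (simp add: rho_def powr_mult powr_powr mult_ac)

lemma rho_minus: "rho \<alpha> (- d) s = inverse (rho \<alpha> d s)"
  by (simp add: rho_def powr_minus)

text \<open>The logarithm enters with a nonpositive exponent, so its factor increases with s and can
  be moved from s to u for free; the pure power supplies the decay.\<close>

lemma rho_le:
  assumes "0 < s" "s \<le> u" "u \<le> 1" "0 \<le> d" "0 \<le> \<alpha>"
  shows "rho \<alpha> d s \<le> (s / u) powr d * rho \<alpha> d u"
proof -
  have "(1 - ln s) powr (- \<alpha> * d) \<le> (1 - ln u) powr (- \<alpha> * d)"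
    using assms ln_less_1[of u] by (intro powr_mono2') auto
  then have "s powr d * (1 - ln s) powr (- \<alpha> * d) \<le> s powr d * (1 - ln u) powr (- \<alpha> * d)"
    by (intro mult_left_mono) auto
  also have "\<dots> = (s / u) powr d * rho \<alpha> d u"
    using assms by (simp add: rho_def powr_divide)
  finally show ?thesis
    by (simp add: rho_def)
qed

text \<open>The logarithmic factor decreases, so doubling the argument costs only the factor from
  the power. This undoes the shift from u to 2u caused by \<open>rearr_add_le\<close>.\<close>

lemma phi_double_le:
  assumes "0 < u" "2 * u \<le> 1" "0 \<le> \<alpha>" "x \<le> 1"
  shows "phi \<alpha> x (2 * u) \<le> 2 powr x * phi \<alpha> x u"
proof -
  have "(1 - ln (2 * u)) powr (\<alpha> * (1 - x)) \<le> (1 - ln u) powr (\<alpha> * (1 - x))"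
    using assms ln_less_1[of "2 * u"] by (intro powr_mono2) auto
  then show ?thesis
    using assms by (simp add: phi_def powr_mult mult_left_mono)
qed

text \<open>Since \<open>1 - ln s = (1 - ln u) + ln (u / s)\<close>, the logarithmic factor costs only
  an arbitrarily small power of \<open>u / s\<close>.\<close>

lemma phi_le:
  assumes x: "0 < x" "x < 1" and \<alpha>: "0 < \<alpha>"
  obtains C where "0 < C"
    "\<And>s u. 0 < s \<Longrightarrow> s \<le> u \<Longrightarrow> u \<le> 1 \<Longrightarrow> phi \<alpha> x s \<le> C * phi \<alpha> x u * (s / u) powr (x / 2)"
proof
  define a where "a = \<alpha> * (1 - x)"
  \<comment> \<open>The bound x / (2 a) keeps the loss y^(\<kappa> a) below y^(x/2), half of the
    available power. The bound 1 lets the constant term in 1 + ln y be absorbed in y^\<kappa> /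
    \<kappa>.\<close>
  define \<kappa> where "\<kappa> = min 1 (x / (2 * a))"
  have a: "0 < a" and \<kappa>: "0 < \<kappa>" "\<kappa> \<le> 1" "\<kappa> * a \<le> x / 2"
    using x \<alpha> by (auto simp: a_def \<kappa>_def min_def field_simps)
  show "0 < \<kappa> powr - a"
    using \<kappa> by simp
  fix s u :: real
  assume su: "0 < s" "s \<le> u" "u \<le> 1"
  define y where "y = u / s"
  have y: "1 \<le> y"
    using su by (simp add: y_def)
  have "\<kappa> * ln y \<le> y powr \<kappa> - 1"
    using y \<kappa> ln_le_minus_one[of "y powr \<kappa>"] by (simp add: ln_powr)
  then have "\<kappa> * (1 + ln y) \<le> y powr \<kappa>"
    using \<kappa> by (simp add: algebra_simps)
  then have ln_y: "1 + ln y \<le> y powr \<kappa> / \<kappa>"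
    using \<kappa> by (simp add: field_simps)
  have "1 - ln s = (1 - ln u) + ln y"
    using su by (simp add: y_def ln_div)
  \<comment> \<open>A sum becomes a product because 1 - ln u \<ge> 1 and ln y \<ge> 0.\<close>
  also have "\<dots> \<le> (1 - ln u) * (1 + ln y)"
    using su y by (simp add: algebra_simps mult_nonpos_nonneg)
  also have "\<dots> \<le> (1 - ln u) * (y powr \<kappa> / \<kappa>)"
    using su ln_y ln_less_1[of u] by (intro mult_left_mono) auto
  finally have "(1 - ln s) powr a \<le> ((1 - ln u) * (y powr \<kappa> / \<kappa>)) powr a"
    using su a ln_less_1[of s] by (intro powr_mono2) auto
  also have "\<dots> = (1 - ln u) powr a * y powr (\<kappa> * a) * \<kappa> powr - a"
    using su \<kappa> ln_less_1[of u]
    by (simp add: powr_mult powr_divide powr_powr powr_minus divide_simps)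
  also have "\<dots> \<le> (1 - ln u) powr a * y powr (x / 2) * \<kappa> powr - a"
    using y \<kappa> by (intro mult_left_mono mult_right_mono powr_mono) auto
  finally have "s powr x * (1 - ln s) powr a
      \<le> s powr x * ((1 - ln u) powr a * y powr (x / 2) * \<kappa> powr - a)"
    by (rule mult_left_mono) simp
  also have "\<dots> = \<kappa> powr - a * (u powr x * (1 - ln u) powr a) * (s powr x * u powr - x * y powr (x / 2))"
    using su by (simp add: powr_minus field_simps)
  also have "s powr x * u powr - x * y powr (x / 2) = (s / u) powr (x / 2)"
  proof -
    have "s powr x * u powr - x = (s / u) powr (x / 2) * (s / u) powr (x / 2)"
      using su by (simp add: powr_divide powr_minus field_simps flip: powr_add)
    moreover have "(s / u) powr (x / 2) * y powr (x / 2) = 1"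
      using su by (simp add: y_def flip: powr_mult)
    ultimately show ?thesis
      by (simp add: mult.assoc)
  qed
  finally show "phi \<alpha> x s \<le> \<kappa> powr - a * phi \<alpha> x u * (s / u) powr (x / 2)"
    by (simp add: phi_def a_def)
qed

text \<open>After \<open>phi_le\<close> only the integral of (s/u)^(x/2) ds/s over (0,u) is left,
  which is 2/x. With x = 1/q this bounds the norm contribution on (0,u) of a function that is
  constant there.\<close>

lemma nn_integral_phi_le:
  assumes x: "0 < x" "x < 1" and \<alpha>: "0 < \<alpha>"
  obtains C where "0 < C"
    "\<And>u. 0 < u \<Longrightarrow> u < 1 \<Longrightarrow>
      (\<integral>\<^sup>+s. ennreal (phi \<alpha> x s) * indicator {..<u} s \<partial>log_measure) \<le> ennreal (C * phi \<alpha> x u)"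
proof -
  obtain C where C: "0 < C"
    "\<And>s u. 0 < s \<Longrightarrow> s \<le> u \<Longrightarrow> u \<le> 1 \<Longrightarrow> phi \<alpha> x s \<le> C * phi \<alpha> x u * (s / u) powr (x / 2)"
    by (rule phi_le[OF assms]) blast
  have le: "(\<integral>\<^sup>+s. ennreal (phi \<alpha> x s) * indicator {..<u} s \<partial>log_measure) \<le> ennreal (2 / x * C * phi \<alpha> x u)"
    if u: "0 < u" "u < 1" for u
  proof -
    have "(\<integral>\<^sup>+s. ennreal (phi \<alpha> x s) * indicator {..<u} s \<partial>log_measure)
        \<le> (\<integral>\<^sup>+s. ennreal (C * phi \<alpha> x u) * (ennreal ((s / u) powr (x / 2)) * indicator {..<u} s) \<partial>log_measure)"
      using u C by (intro nn_integral_log_measure_mono)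
        (auto simp: indicator_def phi_nonneg simp flip: ennreal_mult intro!: ennreal_leI)
    also have "\<dots> = ennreal (C * phi \<alpha> x u) * ennreal (1 / (x / 2))"
      using u x by (subst nn_integral_cmult) (simp_all add: nn_integral_log_measure_less)
    also have "\<dots> = ennreal (2 / x * C * phi \<alpha> x u)"
      using C x by (simp add: phi_nonneg mult_ac flip: ennreal_mult)
    finally show ?thesis .
  qed
  show thesis
    using C x by (intro that[of "2 / x * C"] le) simp_all
qed

text \<open>For a = \<alpha> (1 - 1/p) this is the tail of the outer weight in the small Lebesgue
  norm. The subtracted 1 comes from the endpoint t = 1 and forces some care when v is near
  1.\<close>

lemma nn_integral_log_powr:
  assumes "0 < a" "0 < v" "v \<le> 1"
  shows "(\<integral>\<^sup>+t\<in>{v<..<1}. ennreal ((1 - ln t) powr (a - 1) * (1 / t)) \<partial>lborel)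
      = ennreal (((1 - ln v) powr a - 1) / a)"
proof -
  have "(\<integral>\<^sup>+t\<in>{v<..<1}. ennreal ((1 - ln t) powr (a - 1) * (1 / t)) \<partial>lborel)
      = ennreal (- ((1 - ln 1) powr a) / a - - ((1 - ln v) powr a) / a)"
  proof (rule nn_integral_FTC_open)
    fix t :: real assume t: "v \<le> t" "t \<le> 1"
    then have "0 < 1 - ln t" "0 < t"
      using assms ln_less_1[of t] by auto
    then show "((\<lambda>t. - ((1 - ln t) powr a) / a) has_real_derivative (1 - ln t) powr (a - 1) * (1 / t)) (at t)"
      using assms by (auto intro!: derivative_eq_intros simp: divide_simps powr_diff)
  qed (use assms in auto)
  then show ?thesis
    by (simp add: diff_divide_distrib)
qed

section \<open>Weak and Lorentz bounds for the small Lebesgue norm\<close>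

context unit_domain
begin

text \<open>Since f* decreases, for t > v = u/2 the inner integral is at least v f*(u)^p. This
  constant leaves the outer integral over (v,1), and the tail of the outer weight supplies the
  logarithm.\<close>

lemma small_leb_norm_ge:
  assumes p: "1 < p" and \<alpha>: "0 < \<alpha>"
  obtains c where "0 < c"
    "\<And>f u. meas_on \<Omega> f \<Longrightarrow> 0 < u \<Longrightarrow> u < 1 \<Longrightarrow>
       ennreal (c * phi \<alpha> (1 / p) u * decr f u) \<le> small_leb_norm \<Omega> p \<alpha> f"
proof -
  define a where "a = \<alpha> * (1 - 1 / p)"
  have a: "0 < a" "- \<alpha> / p + \<alpha> - 1 = a - 1"
    using p \<alpha> by (auto simp: a_def field_simps)
  have eq: "ennreal ((1 - ln t) powr (a - 1) / t) = ennreal ((1 - ln t) powr (a - 1)) * ennreal (1 / t)"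
    if "0 < t" for t
    using that ennreal_mult[of "(1 - ln t) powr (a - 1)" "1 / t"] by simp
  \<comment> \<open>As u < 1, the number X = (1 - ln (u/2))^a is at least (1 + ln 2)^a, and on that
    range X - 1 \<ge> \<kappa> X.\<close>
  define \<kappa> where "\<kappa> = 1 - (1 + ln 2) powr - a"
  have "(1 + ln 2) powr - a < (1::real) powr - a"
    using a by (intro powr_less_mono2_neg) auto
  then have \<kappa>: "0 < \<kappa>"
    by (simp add: \<kappa>_def)
  have le: "ennreal ((1 / 2) powr (1 / p) * \<kappa> / a * phi \<alpha> (1 / p) u * decr f u) \<le> small_leb_norm \<Omega> p \<alpha> f"
    if f: "meas_on \<Omega> f" and u: "0 < u" "u < 1" for f u
  proof -
    \<comment> \<open>Cutting at u itself would fail near u = 1: the outer integral over (u,1) tends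
      to 0 there, while phi(u) tends to 1.\<close>
    define v where "v = u / 2"
    have v: "0 < v" "v < u" "v < 1"
      using u by (auto simp: v_def)
    have inner: "ennreal (v powr (1 / p) * decr f u)
        \<le> epow (\<integral>\<^sup>+\<sigma>\<in>{0<..<t}. ennreal (rearr \<Omega> f \<sigma> powr p) \<partial>lborel) (1 / p)"
      if "v < t" for t
    proof -
      have "ennreal (decr f u powr p * v) = (\<integral>\<^sup>+\<sigma>. ennreal (decr f u powr p) * indicator {0<..<v} \<sigma> \<partial>lborel)"
        using v f by (subst nn_integral_cmult_indicator) (auto simp: ennreal_mult)
      also have "\<dots> \<le> (\<integral>\<^sup>+\<sigma>\<in>{0<..<t}. ennreal (rearr \<Omega> f \<sigma> powr p) \<partial>lborel)"
        using that v u f p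
        by (intro nn_integral_mono)
          (auto simp: indicator_def decr_eq intro!: ennreal_leI powr_mono2 rearr_antimono rearr_nonneg)
      finally have "epow (ennreal (decr f u powr p * v)) (1 / p)
          \<le> epow (\<integral>\<^sup>+\<sigma>\<in>{0<..<t}. ennreal (rearr \<Omega> f \<sigma> powr p) \<partial>lborel) (1 / p)"
        using p by (intro epow_mono) auto
      then show ?thesis
        using v p decr_nonneg[OF f] by (simp add: epow_ennreal powr_mult powr_powr mult_ac)
    qed
    have "ennreal (((1 - ln v) powr a - 1) / a) * ennreal (v powr (1 / p) * decr f u)
        = (\<integral>\<^sup>+t\<in>{v<..<1}. ennreal ((1 - ln t) powr (a - 1) * (1 / t)) \<partial>lborel) * ennreal (v powr (1 / p) * decr f u)"
      using v a by (subst nn_integral_log_powr) auto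
    also have "\<dots> = (\<integral>\<^sup>+t. ennreal ((1 - ln t) powr (a - 1) * (1 / t)) * indicator {v<..<1} t * ennreal (v powr (1 / p) * decr f u) \<partial>lborel)"
      by (rule nn_integral_multc[symmetric]) measurable
    also have "\<dots> \<le> small_leb_norm \<Omega> p \<alpha> f"
      unfolding small_leb_norm_def a(2)
    proof (rule nn_integral_mono)
      fix t :: real
      let ?I = "epow (\<integral>\<^sup>+\<sigma>\<in>{0<..<t}. ennreal (rearr \<Omega> f \<sigma> powr p) \<partial>lborel) (1 / p)"
      show "ennreal ((1 - ln t) powr (a - 1) * (1 / t)) * indicator {v<..<1} t * ennreal (v powr (1 / p) * decr f u)
        \<le> ennreal ((1 - ln t) powr (a - 1)) * ?I * ennreal (1 / t) * indicator {0<..<1} t"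
      proof (cases "v < t \<and> t < 1")
        case True
        then have "ennreal ((1 - ln t) powr (a - 1) * (1 / t)) * ennreal (v powr (1 / p) * decr f u)
            \<le> ennreal ((1 - ln t) powr (a - 1) * (1 / t)) * ?I"
          by (intro mult_left_mono inner) auto
        then show ?thesis
          using True v by (simp add: eq[of t] mult_ac)
      qed auto
    qed
    finally have 1: "ennreal (((1 - ln v) powr a - 1) / a) * ennreal (v powr (1 / p) * decr f u) \<le> small_leb_norm \<Omega> p \<alpha> f" .
    have ge1: "1 \<le> (1 - ln v) powr a"
      using v a ln_less_1[of v] by (intro ge_one_powr_ge_zero) auto
    have "1 + ln 2 \<le> 1 - ln v"
      using u by (simp add: v_def ln_div)
    then have "(1 - ln v) powr - a \<le> (1 + ln 2) powr - a"
      using a by (intro powr_mono2') (auto simp: add_pos_pos)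
    then have "1 \<le> (1 + ln 2) powr - a * (1 - ln v) powr a"
      using v ln_less_1[of v] by (simp add: powr_minus field_simps)
    then have "\<kappa> * (1 - ln v) powr a \<le> (1 - ln v) powr a - 1"
      by (simp add: \<kappa>_def algebra_simps)
    moreover have "\<kappa> * (1 - ln u) powr a \<le> \<kappa> * (1 - ln v) powr a"
      using u v \<kappa> a ln_less_1[of u] by (intro mult_left_mono powr_mono2) auto
    ultimately have "\<kappa> * (1 - ln u) powr a / a \<le> ((1 - ln v) powr a - 1) / a"
      using a by (intro divide_right_mono) auto
    then have "\<kappa> * (1 - ln u) powr a / a * (v powr (1 / p) * decr f u)
        \<le> ((1 - ln v) powr a - 1) / a * (v powr (1 / p) * decr f u)"
      using decr_nonneg[OF f] by (intro mult_right_mono) auto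
    moreover have "(1 / 2) powr (1 / p) * \<kappa> / a * phi \<alpha> (1 / p) u * decr f u
        = \<kappa> * (1 - ln u) powr a / a * (v powr (1 / p) * decr f u)"
      using u by (simp add: phi_def a_def v_def powr_divide mult_ac)
    ultimately have "ennreal ((1 / 2) powr (1 / p) * \<kappa> / a * phi \<alpha> (1 / p) u * decr f u)
        \<le> ennreal (((1 - ln v) powr a - 1) / a * (v powr (1 / p) * decr f u))"
      by (simp only: ennreal_leI)
    also have "\<dots> = ennreal (((1 - ln v) powr a - 1) / a) * ennreal (v powr (1 / p) * decr f u)"
      using ge1 a decr_nonneg[OF f] by (intro ennreal_mult) auto
    finally show ?thesis
      using 1 by (rule order.trans)
  qed
  show thesis
    using a \<kappa> by (intro that[OF _ le]) auto
qed

lemma Lp_rearr_le: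
  assumes f: "meas_on \<Omega> f" and p: "1 \<le> p" and t: "0 < t"
  shows "epow (\<integral>\<^sup>+\<sigma>\<in>{0<..<t}. ennreal (rearr \<Omega> f \<sigma> powr p) \<partial>lborel) (1 / p)
     \<le> (\<integral>\<^sup>+\<sigma>\<in>{0<..<t}. ennreal (\<sigma> powr (1 / p - 1) * decr f \<sigma>) \<partial>lborel)" (is "_ \<le> ?G")
proof (cases "?G = top")
  case False
  then obtain \<gamma> where \<gamma>: "0 \<le> \<gamma>" "?G = ennreal \<gamma>"
    by (cases ?G) auto
  have [measurable]: "decr f \<in> borel_measurable borel"
    using f by measurable
  have bound: "u powr (1 / p) * decr f u \<le> \<gamma>" if u: "0 < u" "u < t" for u
  proof -
    have "ennreal (u powr (1 / p) * decr f u) = ennreal (u powr (1 / p - 1) * decr f u) * emeasure lborel {0<..<u}"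
      using u decr_nonneg[OF f] by (simp add: powr_diff flip: ennreal_mult)
    also have "\<dots> = (\<integral>\<^sup>+\<sigma>. ennreal (u powr (1 / p - 1) * decr f u) * indicator {0<..<u} \<sigma> \<partial>lborel)"
      by (subst nn_integral_cmult_indicator) auto
    also have "\<dots> \<le> ?G"
      using u f p decr_nonneg[OF f]
      by (intro nn_integral_mono)
        (auto simp: indicator_def intro!: ennreal_leI mult_mono powr_mono2' decr_antimono)
    finally show ?thesis
      using \<gamma> by simp
  qed
  have "(\<integral>\<^sup>+\<sigma>\<in>{0<..<t}. ennreal (rearr \<Omega> f \<sigma> powr p) \<partial>lborel)
      \<le> (\<integral>\<^sup>+\<sigma>. ennreal (\<gamma> powr (p - 1)) * (ennreal (\<sigma> powr (1 / p - 1) * decr f \<sigma>) * indicator {0<..<t} \<sigma>) \<partial>lborel)"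
  proof (rule nn_integral_mono)
    fix \<sigma> :: real
    have "rearr \<Omega> f \<sigma> powr p \<le> \<gamma> powr (p - 1) * (\<sigma> powr (1 / p - 1) * decr f \<sigma>)" if \<sigma>: "0 < \<sigma>" "\<sigma> < t"
    proof (cases "decr f \<sigma> = 0")
      case False
      have "(\<sigma> powr (1 / p) * decr f \<sigma>) powr (p - 1) \<le> \<gamma> powr (p - 1)"
        using bound[OF \<sigma>] p decr_nonneg[OF f] by (intro powr_mono2) auto
      then have "(\<sigma> powr (1 / p) * decr f \<sigma>) powr (p - 1) * (\<sigma> powr (1 / p - 1) * decr f \<sigma>)
          \<le> \<gamma> powr (p - 1) * (\<sigma> powr (1 / p - 1) * decr f \<sigma>)"
        using decr_nonneg[OF f] by (intro mult_right_mono) auto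
      also have "(\<sigma> powr (1 / p) * decr f \<sigma>) powr (p - 1) * (\<sigma> powr (1 / p - 1) * decr f \<sigma>)
          = \<sigma> powr ((1 / p) * (p - 1) + (1 / p - 1)) * (decr f \<sigma> powr (p - 1) * decr f \<sigma> powr 1)"
        using \<sigma> decr_nonneg[OF f, of \<sigma>] by (simp add: powr_mult powr_powr powr_add)
      also have "\<dots> = decr f \<sigma> powr p"
      proof -
        have "(1 / p) * (p - 1) + (1 / p - 1) = 0"
          using p by (simp add: field_simps)
        then show ?thesis
          using \<sigma> by (simp only: flip: powr_add) simp
      qed
      finally show ?thesis
        using \<sigma> by (simp add: decr_eq)
    qed (use \<sigma> in \<open>simp add: decr_eq\<close>)
    then show "ennreal (rearr \<Omega> f \<sigma> powr p) * indicator {0<..<t} \<sigma>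
       \<le> ennreal (\<gamma> powr (p - 1)) * (ennreal (\<sigma> powr (1 / p - 1) * decr f \<sigma>) * indicator {0<..<t} \<sigma>)"
      using decr_nonneg[OF f, of \<sigma>]
      by (auto simp: indicator_def intro!: ennreal_leI simp flip: ennreal_mult)
  qed
  also have "\<dots> = ennreal (\<gamma> powr (p - 1)) * ?G"
    by (rule nn_integral_cmult) measurable
  also have "\<dots> = ennreal (\<gamma> powr p)"
  proof (cases "\<gamma> = 0")
    case False
    then have "\<gamma> powr (p - 1) * \<gamma> = \<gamma> powr p"
      using \<gamma> by (simp add: powr_diff)
    then show ?thesis
      using \<gamma> by (simp flip: ennreal_mult)
  qed (use \<gamma> in simp)
  finally have "epow (\<integral>\<^sup>+\<sigma>\<in>{0<..<t}. ennreal (rearr \<Omega> f \<sigma> powr p) \<partial>lborel) (1 / p) \<le> epow (ennreal (\<gamma> powr p)) (1 / p)"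
    using p by (intro epow_mono) auto
  also have "\<dots> = ?G"
    using \<gamma> p by (simp add: epow_ennreal powr_powr)
  finally show ?thesis .
qed auto

text \<open>The embedding \<open>Lp_rearr_le\<close> replaces the inner norm by an expression linear
  in f*. The order of integration can then be exchanged, and the integral over the outer variable is
  the tail in \<open>nn_integral_log_powr\<close>.\<close>

lemma small_leb_norm_le:
  assumes p: "1 < p" and \<alpha>: "0 < \<alpha>" and f: "meas_on \<Omega> f"
  shows "small_leb_norm \<Omega> p \<alpha> f
     \<le> ennreal (1 / (\<alpha> * (1 - 1 / p))) * (\<integral>\<^sup>+s. ennreal (phi \<alpha> (1 / p) s * decr f s) \<partial>log_measure)"
proof -
  define a where "a = \<alpha> * (1 - 1 / p)"
  have a: "0 < a" "- \<alpha> / p + \<alpha> - 1 = a - 1"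
    using p \<alpha> by (auto simp: a_def field_simps)
  have [measurable]: "decr f \<in> borel_measurable borel"
    using f by measurable
  have eq: "ennreal ((1 - ln t) powr (a - 1) / t) = ennreal ((1 - ln t) powr (a - 1)) * ennreal (1 / t)"
    if "0 < t" for t
    using that ennreal_mult[of "(1 - ln t) powr (a - 1)" "1 / t"] by simp
  \<comment> \<open>Extension by 0 outside the triangle 0 < \<sigma> < t < 1 lets both iterated
    integrals run over the whole line.\<close>
  define H :: "real \<Rightarrow> real \<Rightarrow> ennreal" where "H \<sigma> t = (if 0 < \<sigma> \<and> \<sigma> < t \<and> t < 1 then
      ennreal (\<sigma> powr (1 / p - 1) * decr f \<sigma>) * ennreal ((1 - ln t) powr (a - 1) * (1 / t)) else 0)" for \<sigma> t
  have [measurable]: "case_prod H \<in> borel_measurable (lborel \<Otimes>\<^sub>M lborel)"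
    unfolding H_def by measurable
  have "small_leb_norm \<Omega> p \<alpha> f \<le> (\<integral>\<^sup>+t. (\<integral>\<^sup>+\<sigma>. H \<sigma> t \<partial>lborel) \<partial>lborel)"
    unfolding small_leb_norm_def a(2)
  proof (rule nn_integral_mono)
    fix t :: real
    let ?I = "epow (\<integral>\<^sup>+\<sigma>\<in>{0<..<t}. ennreal (rearr \<Omega> f \<sigma> powr p) \<partial>lborel) (1 / p)"
    show "ennreal ((1 - ln t) powr (a - 1)) * ?I * ennreal (1 / t) * indicator {0<..<1} t \<le> (\<integral>\<^sup>+\<sigma>. H \<sigma> t \<partial>lborel)"
    proof (cases "0 < t \<and> t < 1")
      case True
      then have "ennreal ((1 - ln t) powr (a - 1)) * ?I * ennreal (1 / t) * indicator {0<..<1} t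
          = ?I * ennreal ((1 - ln t) powr (a - 1) * (1 / t))"
        by (simp add: eq mult_ac)
      also have "\<dots> \<le> (\<integral>\<^sup>+\<sigma>\<in>{0<..<t}. ennreal (\<sigma> powr (1 / p - 1) * decr f \<sigma>) \<partial>lborel) * ennreal ((1 - ln t) powr (a - 1) * (1 / t))"
        using p f True by (intro mult_right_mono Lp_rearr_le) auto
      also have "\<dots> = (\<integral>\<^sup>+\<sigma>. ennreal (\<sigma> powr (1 / p - 1) * decr f \<sigma>) * indicator {0<..<t} \<sigma> * ennreal ((1 - ln t) powr (a - 1) * (1 / t)) \<partial>lborel)"
        by (rule nn_integral_multc[symmetric]) measurable
      also have "\<dots> = (\<integral>\<^sup>+\<sigma>. H \<sigma> t \<partial>lborel)"
        using True by (intro nn_integral_cong) (auto simp: H_def indicator_def)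
      finally show ?thesis .
    qed auto
  qed
  also have "\<dots> = (\<integral>\<^sup>+\<sigma>. (\<integral>\<^sup>+t. H \<sigma> t \<partial>lborel) \<partial>lborel)"
    by (rule lborel_pair.Fubini') measurable
  also have "\<dots> \<le> (\<integral>\<^sup>+\<sigma>. ennreal (1 / a) * (ennreal (phi \<alpha> (1 / p) \<sigma> * decr f \<sigma>) * ennreal (1 / \<sigma>) * indicator {0<..<1} \<sigma>) \<partial>lborel)"
  proof (rule nn_integral_mono)
    fix \<sigma> :: real
    show "(\<integral>\<^sup>+t. H \<sigma> t \<partial>lborel) \<le> ennreal (1 / a) * (ennreal (phi \<alpha> (1 / p) \<sigma> * decr f \<sigma>) * ennreal (1 / \<sigma>) * indicator {0<..<1} \<sigma>)"
    proof (cases "0 < \<sigma> \<and> \<sigma> < 1")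
      case True
      then have "(\<integral>\<^sup>+t. H \<sigma> t \<partial>lborel)
          = (\<integral>\<^sup>+t. ennreal (\<sigma> powr (1 / p - 1) * decr f \<sigma>) * (ennreal ((1 - ln t) powr (a - 1) * (1 / t)) * indicator {\<sigma><..<1} t) \<partial>lborel)"
        by (intro nn_integral_cong) (auto simp: H_def indicator_def)
      also have "\<dots> = ennreal (\<sigma> powr (1 / p - 1) * decr f \<sigma>) * ennreal (((1 - ln \<sigma>) powr a - 1) / a)"
        using True a(1) by (subst nn_integral_cmult, measurable, subst nn_integral_log_powr) auto
      also have "\<dots> \<le> ennreal (\<sigma> powr (1 / p - 1) * decr f \<sigma>) * ennreal ((1 - ln \<sigma>) powr a / a)"
        using a by (intro mult_left_mono ennreal_leI divide_right_mono) auto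
      also have "\<dots> = ennreal (1 / a) * (ennreal (phi \<alpha> (1 / p) \<sigma> * decr f \<sigma>) * ennreal (1 / \<sigma>) * indicator {0<..<1} \<sigma>)"
        using True a decr_nonneg[OF f, of \<sigma>]
        by (simp add: phi_def powr_diff a_def mult_ac flip: ennreal_mult)
      finally show ?thesis .
    next
      case False
      then have "H \<sigma> t = 0" for t
        by (auto simp: H_def)
      then show ?thesis by simp
    qed
  qed
  also have "\<dots> = ennreal (1 / a) * (\<integral>\<^sup>+s. ennreal (phi \<alpha> (1 / p) s * decr f s) \<partial>log_measure)"
    by (subst nn_integral_log_measure) (auto intro!: nn_integral_cmult)
  finally show ?thesis
    by (simp add: a_def)
qed

end

section \<open>The Hardy operator\<close>

text \<open>A crude form of Hoelder's inequality: bound \<open>k\<close> by \<open>c powr (1 - r) * k powr r + c\<close>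
  and choose \<open>c\<close> optimally.\<close>

lemma epow_nn_integral_le:
  assumes [measurable]: "w \<in> borel_measurable M" "k \<in> borel_measurable M"
    and w: "(\<integral>\<^sup>+s. w s \<partial>M) \<le> ennreal A" and A: "0 < A" and r: "1 < r"
  shows "epow (\<integral>\<^sup>+s. w s * k s \<partial>M) r
     \<le> ennreal (2 powr r * A powr (r - 1)) * (\<integral>\<^sup>+s. w s * epow (k s) r \<partial>M)" (is "_ \<le> _ * ?J")
proof -
  consider "?J = top" | "?J = 0" | j where "0 < j" "?J = ennreal j"
    by (cases ?J) (auto simp: less_le)
  then show ?thesis
  proof cases
    case 1
    then show ?thesis
      using A by (simp add: ennreal_mult_top)
  next
    \<comment> \<open>The balancing value of c would be 0 here; instead, w k^r = 0 almost everywhere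
      already forces w k = 0 almost everywhere.\<close>
    case 2
    then have "AE s in M. w s * epow (k s) r = 0"
      by (subst (asm) nn_integral_0_iff_AE) auto
    then have "AE s in M. w s * k s = 0"
      by eventually_elim auto
    then have "(\<integral>\<^sup>+s. w s * k s \<partial>M) = 0"
      by (subst nn_integral_0_iff_AE) auto
    then show ?thesis by simp
  next
    case (3 j)
    \<comment> \<open>With c^r = j / A the two terms c^(1-r) j and c A coincide.\<close>
    define c where "c = (j / A) powr (1 / r)"
    have c: "0 < c" "c powr r = j / A"
      using 3 A r by (auto simp: c_def powr_powr)
    have k_le: "k s \<le> ennreal (c powr (1 - r)) * epow (k s) r + ennreal c" for s
    proof (cases "k s")
      case (real y)
      show ?thesis
      proof (cases "y \<le> c")
        case True
        then show ?thesis
          using real by (auto intro: order.trans[OF _ add_increasing[OF _ order.refl]] ennreal_leI)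
      next
        case False
        then have "c powr (1 - r) * c powr (r - 1) \<le> c powr (1 - r) * y powr (r - 1)"
          using c r by (intro mult_left_mono powr_mono2) auto
        moreover have "c powr (1 - r) * c powr (r - 1) = 1"
          using c by (simp flip: powr_add)
        ultimately have "1 * y \<le> (c powr (1 - r) * y powr (r - 1)) * y"
          using False c by (intro mult_right_mono) auto
        also have "\<dots> = c powr (1 - r) * y powr r"
          using False c by (simp add: powr_diff)
        finally have "k s \<le> ennreal (c powr (1 - r)) * epow (k s) r"
          using real by (auto simp: epow_ennreal intro!: ennreal_leI simp flip: ennreal_mult)
        then show ?thesis
          by (rule order.trans) simp
      qed
    qed (use c in \<open>simp add: ennreal_mult_top\<close>)
    have "(\<integral>\<^sup>+s. w s * k s \<partial>M)
        \<le> (\<integral>\<^sup>+s. ennreal (c powr (1 - r)) * (w s * epow (k s) r) + ennreal c * w s \<partial>M)"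
    proof (rule nn_integral_mono)
      fix s
      have "w s * k s \<le> w s * (ennreal (c powr (1 - r)) * epow (k s) r + ennreal c)"
        by (intro mult_left_mono k_le) auto
      then show "w s * k s \<le> ennreal (c powr (1 - r)) * (w s * epow (k s) r) + ennreal c * w s"
        by (simp add: distrib_left mult_ac)
    qed
    also have "\<dots> = ennreal (c powr (1 - r)) * ?J + ennreal c * (\<integral>\<^sup>+s. w s \<partial>M)"
      by (simp add: nn_integral_add nn_integral_cmult)
    also have "\<dots> \<le> ennreal (c powr (1 - r)) * ennreal j + ennreal c * ennreal A"
      using w 3 by (intro add_mono mult_left_mono) auto
    also have "\<dots> = ennreal (2 * c * A)"
    proof -
      have "c powr (1 - r) * (c powr r * A) = c * A"
        using c(1) by (simp add: powr_diff)
      then have "c powr (1 - r) * j = c * A"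
        using c(2) A by simp
      then show ?thesis
        using c A 3 by (simp flip: ennreal_mult ennreal_plus)
    qed
    finally have "epow (\<integral>\<^sup>+s. w s * k s \<partial>M) r \<le> epow (ennreal (2 * c * A)) r"
      using r by (intro epow_mono) auto
    also have "\<dots> = ennreal (2 powr r * (c powr r * A powr r))"
      using c A by (simp add: epow_ennreal powr_mult mult_ac)
    also have "\<dots> = ennreal (2 powr r * A powr (r - 1)) * ?J"
      using c A 3 by (simp add: powr_diff flip: ennreal_mult)
    finally show ?thesis .
  qed
qed

text \<open>Hoelder's inequality is applied in each row with the kernel as weight, which costs
  A^(r-1); after exchanging the integrals the column bound gives the remaining factor A.\<close>

lemma schur_test:
  fixes e :: "'a \<Rightarrow> 'a \<Rightarrow> ennreal"
  assumes "sigma_finite_measure M"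
    and e [measurable]: "case_prod e \<in> borel_measurable (M \<Otimes>\<^sub>M M)"
    and k [measurable]: "k \<in> borel_measurable M"
    and rows: "AE u in M. (\<integral>\<^sup>+s. e u s \<partial>M) \<le> ennreal A"
    and cols: "AE s in M. (\<integral>\<^sup>+u. e u s \<partial>M) \<le> ennreal A"
    and A: "0 < A" and r: "1 < r"
  shows "(\<integral>\<^sup>+u. epow (\<integral>\<^sup>+s. e u s * k s \<partial>M) r \<partial>M) \<le> ennreal ((2 * A) powr r) * (\<integral>\<^sup>+s. epow (k s) r \<partial>M)"
proof -
  interpret sigma_finite_measure M by fact
  interpret pair_sigma_finite M M ..
  have "(\<integral>\<^sup>+u. epow (\<integral>\<^sup>+s. e u s * k s \<partial>M) r \<partial>M)
      \<le> (\<integral>\<^sup>+u. ennreal (2 powr r * A powr (r - 1)) * (\<integral>\<^sup>+s. e u s * epow (k s) r \<partial>M) \<partial>M)"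
    by (rule nn_integral_mono_AE) (use rows A r in \<open>auto elim!: AE_mp intro!: epow_nn_integral_le\<close>)
  also have "\<dots> = ennreal (2 powr r * A powr (r - 1)) * (\<integral>\<^sup>+u. (\<integral>\<^sup>+s. e u s * epow (k s) r \<partial>M) \<partial>M)"
    by (rule nn_integral_cmult) measurable
  also have "(\<integral>\<^sup>+u. (\<integral>\<^sup>+s. e u s * epow (k s) r \<partial>M) \<partial>M) = (\<integral>\<^sup>+s. (\<integral>\<^sup>+u. e u s * epow (k s) r \<partial>M) \<partial>M)"
    by (rule Fubini'[symmetric]) measurable
  also have "\<dots> = (\<integral>\<^sup>+s. (\<integral>\<^sup>+u. e u s \<partial>M) * epow (k s) r \<partial>M)"
    by (intro nn_integral_cong nn_integral_multc) measurable
  also have "\<dots> \<le> (\<integral>\<^sup>+s. ennreal A * epow (k s) r \<partial>M)"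
    by (rule nn_integral_mono_AE) (use cols in \<open>auto elim!: AE_mp intro!: mult_right_mono\<close>)
  also have "\<dots> = ennreal A * (\<integral>\<^sup>+s. epow (k s) r \<partial>M)"
    by (rule nn_integral_cmult) measurable
  finally have "(\<integral>\<^sup>+u. epow (\<integral>\<^sup>+s. e u s * k s \<partial>M) r \<partial>M)
     \<le> ennreal (2 powr r * A powr (r - 1)) * (ennreal A * (\<integral>\<^sup>+s. epow (k s) r \<partial>M))"
    by (simp add: mult_left_mono)
  also have "\<dots> = ennreal ((2 * A) powr r) * (\<integral>\<^sup>+s. epow (k s) r \<partial>M)"
    using A by (simp add: powr_mult powr_diff mult.assoc[symmetric] flip: ennreal_mult)
  finally show ?thesis .
qed

text \<open>In the variable ln s this is the convolution kernel exp(-b |x - y|). Its halves s < u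
  and s > u are a Hardy averaging kernel and its dual.\<close>

definition hardy_kernel :: "real \<Rightarrow> real \<Rightarrow> real \<Rightarrow> ennreal"
  where "hardy_kernel b u s = ennreal (min (s / u) (u / s) powr b)"

text \<open>Each half of a row has mass at most 1/b, and the kernel is symmetric, so rows and
  columns share the bound A = 2/b of Schur's test.\<close>

lemma hardy_inequality:
  assumes b: "0 < b" and r: "1 < r" and [measurable]: "k \<in> borel_measurable borel"
  shows "(\<integral>\<^sup>+u. epow (\<integral>\<^sup>+s. hardy_kernel b u s * k s \<partial>log_measure) r \<partial>log_measure)
     \<le> ennreal ((4 / b) powr r) * (\<integral>\<^sup>+s. epow (k s) r \<partial>log_measure)"
proof -
  have row: "(\<integral>\<^sup>+s. hardy_kernel b u s \<partial>log_measure) \<le> ennreal (2 / b)" if u: "0 < u" "u < 1" for u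
  proof -
    \<comment> \<open>The diagonal belongs to neither of the two strict halves into which the row is
      split.\<close>
    have "AE s in log_measure. s \<noteq> u"
      unfolding log_measure_def by (subst AE_density) (auto intro: AE_mp[OF AE_lborel_singleton[of u]])
    then have "(\<integral>\<^sup>+s. hardy_kernel b u s \<partial>log_measure)
        \<le> (\<integral>\<^sup>+s. ennreal ((s / u) powr b) * indicator {..<u} s
               + ennreal ((u / s) powr b) * indicator {u<..} s \<partial>log_measure)"
      using AE_log_measure
    proof (intro nn_integral_mono_AE, eventually_elim)
      case (elim s)
      then have "min (s / u) (u / s) = (if s < u then s / u else u / s)"
      proof (cases "s < u")
        case True
        then have "s / u \<le> 1" "1 \<le> u / s"
          using u elim by auto
        with True show ?thesis by simp
      next
        case False
        then have "u / s \<le> 1" "1 \<le> s / u"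
          using u elim by auto
        with False show ?thesis by simp
      qed
      then show ?case
        using elim by (auto simp: hardy_kernel_def indicator_def)
    qed
    also have "\<dots> = (\<integral>\<^sup>+s. ennreal ((s / u) powr b) * indicator {..<u} s \<partial>log_measure)
               + (\<integral>\<^sup>+s. ennreal ((u / s) powr b) * indicator {u<..} s \<partial>log_measure)"
      by (rule nn_integral_add) measurable
    also have "\<dots> \<le> ennreal (1 / b) + ennreal (1 / b)"
      using u b nn_integral_log_measure_less[of b u] nn_integral_log_measure_greater[of b u]
      by (intro add_mono) auto
    also have "\<dots> = ennreal (2 / b)"
      using b by (simp flip: ennreal_plus)
    finally show ?thesis .
  qed
  have sym: "hardy_kernel b u s = hardy_kernel b s u" for u s
    by (simp add: hardy_kernel_def min.commute)
  have rows: "AE u in log_measure. (\<integral>\<^sup>+s. hardy_kernel b u s \<partial>log_measure) \<le> ennreal (2 / b)"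
    using AE_log_measure by (rule eventually_mono) (use row in auto)
  have "(\<integral>\<^sup>+u. epow (\<integral>\<^sup>+s. hardy_kernel b u s * k s \<partial>log_measure) r \<partial>log_measure)
     \<le> ennreal ((2 * (2 / b)) powr r) * (\<integral>\<^sup>+s. epow (k s) r \<partial>log_measure)"
  proof (rule schur_test)
    show "AE s in log_measure. (\<integral>\<^sup>+u. hardy_kernel b u s \<partial>log_measure) \<le> ennreal (2 / b)"
      by (subst sym) (rule rows)
    show "case_prod (hardy_kernel b) \<in> borel_measurable (log_measure \<Otimes>\<^sub>M log_measure)"
      unfolding hardy_kernel_def by measurable
  qed (use b r rows sigma_finite_log_measure in auto)
  then show ?thesis by simp
qed

section \<open>Changes of variables\<close>

lemma rho_has_derivative:
  assumes "0 < u" "u \<le> 1"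
  shows "(rho \<alpha> d has_real_derivative rho \<alpha> d u * (d / u * (1 + \<alpha> / (1 - ln u)))) (at u)"
proof -
  have "0 < 1 - ln u"
    using ln_less_1[of u] assms by simp
  then show ?thesis
    using assms unfolding rho_def
    by (auto intro!: derivative_eq_intros simp: powr_diff divide_simps) (simp add: algebra_simps)
qed

text \<open>The map rho is increasing from (0,1] onto (0,1], and the extra factor is its logarithmic
  derivative u rho'(u) / rho(u). The substitution rule on compact intervals is extended to the
  singular endpoint 0 by exhaustion.\<close>

lemma nn_integral_rho_substitution:
  assumes d: "0 < d" and \<alpha>: "0 \<le> \<alpha>" and [measurable]: "F \<in> borel_measurable borel"
  shows "(\<integral>\<^sup>+t. F t \<partial>log_measure)
       = (\<integral>\<^sup>+u. F (rho \<alpha> d u) * ennreal (d * (1 + \<alpha> / (1 - ln u))) \<partial>log_measure)"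
proof -
  define f where "f t = F t * ennreal (1 / t) * indicator {0<..<1} t" for t
  define g' where "g' u = rho \<alpha> d u * (d / u * (1 + \<alpha> / (1 - ln u)))" for u
  have [measurable]: "f \<in> borel_measurable borel" "g' \<in> borel_measurable borel"
    unfolding f_def g'_def by measurable
  \<comment> \<open>Regarding both integrands as densities turns the exhaustion into continuity of
    measures from below.\<close>
  define D1 D2 where "D1 = density lborel f" and "D2 = density lborel (\<lambda>u. f (rho \<alpha> d u) * ennreal (g' u))"
  define a where "a n = 1 / real (n + 2)" for n
  have a: "0 < a n" "a n < 1" for n
    by (auto simp: a_def)
  have ln_pos: "0 < 1 - ln u" if "0 < u" "u \<le> 1" for u :: real
    using that ln_less_1[of u] by simp
  have rho_1: "rho \<alpha> d 1 = 1"
    by (simp add: rho_def)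
  have rho_le_powr: "rho \<alpha> d u \<le> u powr d" if "0 < u" "u \<le> 1" for u
    using rho_le[of u 1 d \<alpha>] that d \<alpha> rho_1 by simp
  have rho_mono: "rho \<alpha> d s \<le> rho \<alpha> d u" if "0 < s" "s \<le> u" "u \<le> 1" for s u
  proof -
    have "rho \<alpha> d s \<le> (s / u) powr d * rho \<alpha> d u"
      using rho_le that d \<alpha> by simp
    also have "\<dots> \<le> 1 * rho \<alpha> d u"
      using that d rho_pos[of u \<alpha> d] by (intro mult_right_mono powr_le1) auto
    finally show ?thesis by simp
  qed
  have eq: "emeasure D1 {rho \<alpha> d (a n)..1} = emeasure D2 {a n..1}" for n
  proof -
    have "(\<integral>\<^sup>+t. f t * indicator {rho \<alpha> d (a n)..rho \<alpha> d 1} t \<partial>lborel)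
        = (\<integral>\<^sup>+u. f (rho \<alpha> d u) * ennreal (g' u) * indicator {a n..1} u \<partial>lborel)"
    proof (rule nn_integral_substitution_aux)
      fix u assume u: "u \<in> {a n..1}"
      then have u': "0 < u" "u \<le> 1"
        using a[of n] by auto
      show "(rho \<alpha> d has_real_derivative g' u) (at u)"
        unfolding g'_def using u' by (rule rho_has_derivative)
      show "0 \<le> g' u"
        using u' d \<alpha> rho_pos[of u \<alpha> d] ln_pos[of u] by (simp add: g'_def)
    next
      have "ln u \<noteq> 1" if "a n \<le> u" "u \<le> 1" for u
        using ln_pos[of u] a[of n] that by auto
      then show "continuous_on {a n..1} g'"
        unfolding g'_def rho_def using a[of n]
        by (intro continuous_intros) auto
    qed (use a in auto)
    then show ?thesis
      by (simp add: D1_def D2_def emeasure_density rho_1)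
  qed
  have dec_a: "a (Suc n) \<le> a n" for n
    by (simp add: a_def divide_simps)
  have a_lim: "a \<longlonglongrightarrow> 0"
    unfolding a_def by (rule LIMSEQ_ignore_initial_segment[OF lim_1_over_n])
  have U2: "(\<Union>n. {a n..1}) = {0<..1}"
  proof safe
    fix u :: real assume "u \<in> {0<..1}"
    moreover from this have "\<forall>\<^sub>F n in sequentially. a n < u"
      using order_tendstoD(2)[OF a_lim] by auto
    ultimately show "u \<in> (\<Union>n. {a n..1})"
      by (auto simp: eventually_sequentially intro: less_imp_le)
  qed (use a in \<open>auto intro: order.strict_trans2\<close>)
  have U1: "(\<Union>n. {rho \<alpha> d (a n)..1}) = {0<..1}"
  proof safe
    fix u :: real assume u: "u \<in> {0<..1}"
    have "(\<lambda>n. a n powr d) \<longlonglongrightarrow> 0"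
      using a_lim d a by (intro tendsto_zero_powrI[where b=d]) (auto intro!: eventuallyI less_imp_le)
    then have "\<forall>\<^sub>F n in sequentially. a n powr d < u"
      using order_tendstoD(2)[of _ 0] u by auto
    then obtain n where "a n powr d < u"
      by (auto simp: eventually_sequentially)
    then show "u \<in> (\<Union>n. {rho \<alpha> d (a n)..1})"
      using u rho_le_powr[of "a n"] a[of n] by (auto intro!: exI[of _ n])
  next
    fix u n assume "u \<in> {rho \<alpha> d (a n)..1}"
    then show "u \<in> {0<..1}"
      using rho_pos[of "a n" \<alpha> d] a[of n] by auto
  qed
  have "emeasure D1 {0<..1} = (SUP n. emeasure D1 {rho \<alpha> d (a n)..1})"
    unfolding U1[symmetric] using order.trans[OF rho_mono[OF a(1) dec_a less_imp_le[OF a(2)]]]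
    by (intro SUP_emeasure_incseq[symmetric]) (auto simp: D1_def intro!: incseq_SucI)
  also have "\<dots> = (SUP n. emeasure D2 {a n..1})"
    by (simp add: eq)
  also have "\<dots> = emeasure D2 {0<..1}"
    unfolding U2[symmetric] using order.trans[OF dec_a]
    by (intro SUP_emeasure_incseq) (auto simp: D2_def intro!: incseq_SucI)
  finally have "emeasure D1 {0<..1} = emeasure D2 {0<..1}" .
  moreover have "emeasure D1 {0<..1} = (\<integral>\<^sup>+t. F t \<partial>log_measure)"
    by (subst nn_integral_log_measure)
      (auto simp: D1_def emeasure_density f_def indicator_def intro!: nn_integral_cong)
  moreover have "emeasure D2 {0<..1} = (\<integral>\<^sup>+u. F (rho \<alpha> d u) * ennreal (d * (1 + \<alpha> / (1 - ln u))) \<partial>log_measure)"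
  proof -
    have "emeasure D2 {0<..1} = (\<integral>\<^sup>+u. f (rho \<alpha> d u) * ennreal (g' u) * indicator {0<..1} u \<partial>lborel)"
      by (simp add: D2_def emeasure_density)
    also have "\<dots> = (\<integral>\<^sup>+u. F (rho \<alpha> d u) * ennreal (d * (1 + \<alpha> / (1 - ln u))) * ennreal (1 / u) * indicator {0<..<1} u \<partial>lborel)"
    proof (rule nn_integral_cong)
      fix u :: real
      \<comment> \<open>The exhaustion covers (0,1] while \<open>log_measure\<close> lives on (0,1);
        at u = 1 both sides vanish because rho(1) = 1.\<close>
      consider "0 < u \<and> u < 1" | "u = 1" | "u \<le> 0 \<or> 1 < u"
        by linarith
      then show "f (rho \<alpha> d u) * ennreal (g' u) * indicator {0<..1} u
        = F (rho \<alpha> d u) * ennreal (d * (1 + \<alpha> / (1 - ln u))) * ennreal (1 / u) * indicator {0<..<1} u"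
      proof cases
        case 1
        then have "rho \<alpha> d u \<le> u powr d" "u powr d < 1 powr d"
          using rho_le_powr[of u] powr_less_mono2[of d u 1] d by auto
        then have R: "0 < rho \<alpha> d u" "rho \<alpha> d u < 1"
          using 1 rho_pos[of u \<alpha> d] by auto
        have nn: "0 \<le> d * (1 + \<alpha> / (1 - ln u))"
          using 1 d \<alpha> ln_pos[of u] by simp
        have "ennreal (1 / rho \<alpha> d u) * ennreal (g' u) = ennreal (1 / rho \<alpha> d u * g' u)"
          using R by (subst ennreal_mult') auto
        also have "1 / rho \<alpha> d u * g' u = d * (1 + \<alpha> / (1 - ln u)) * (1 / u)"
          using R by (simp add: g'_def)
        also have "ennreal \<dots> = ennreal (d * (1 + \<alpha> / (1 - ln u))) * ennreal (1 / u)"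
          using 1 nn by (intro ennreal_mult) auto
        finally show ?thesis
          using 1 R by (simp add: f_def mult.assoc)
      qed (auto simp: f_def rho_1)
    qed
    also have "\<dots> = (\<integral>\<^sup>+u. F (rho \<alpha> d u) * ennreal (d * (1 + \<alpha> / (1 - ln u))) \<partial>log_measure)"
      by (rule nn_integral_log_measure[symmetric]) measurable
    finally show ?thesis .
  qed
  ultimately show ?thesis by simp
qed

text \<open>The measure dv/v is invariant under dilation. The indicator keeps 2u below 1, which is
  precisely where the lower bound for K is available.\<close>

lemma nn_integral_log_measure_double:
  assumes [measurable]: "f \<in> borel_measurable borel"
  shows "(\<integral>\<^sup>+v. f v \<partial>log_measure) = (\<integral>\<^sup>+u. f (2 * u) * indicator {..<1/2} u \<partial>log_measure)"
proof -
  have "(\<integral>\<^sup>+v. f v \<partial>log_measure) = (\<integral>\<^sup>+v. f v * ennreal (1 / v) * indicator {0<..<1} v \<partial>lborel)"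
    by (rule nn_integral_log_measure) measurable
  also have "\<dots> = ennreal 2 * (\<integral>\<^sup>+u. f (2 * u) * ennreal (1 / (2 * u)) * indicator {0<..<1} (2 * u) \<partial>lborel)"
    by (subst nn_integral_real_affine[where c=2 and t=0]) auto
  also have "\<dots> = (\<integral>\<^sup>+u. ennreal 2 * (f (2 * u) * ennreal (1 / (2 * u)) * indicator {0<..<1} (2 * u)) \<partial>lborel)"
    by (rule nn_integral_cmult[symmetric]) measurable
  also have "\<dots> = (\<integral>\<^sup>+u. f (2 * u) * indicator {..<1/2} u * ennreal (1 / u) * indicator {0<..<1} u \<partial>lborel)"
  proof (rule nn_integral_cong)
    fix u :: real
    show "ennreal 2 * (f (2 * u) * ennreal (1 / (2 * u)) * indicator {0<..<1} (2 * u))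
       = f (2 * u) * indicator {..<1/2} u * ennreal (1 / u) * indicator {0<..<1} u"
    proof (cases "0 < u \<and> u < 1/2")
      case True
      have "ennreal 2 * (f (2 * u) * ennreal (1 / (2 * u))) = f (2 * u) * (ennreal 2 * ennreal (1 / (2 * u)))"
        by (simp only: mult_ac)
      also have "ennreal 2 * ennreal (1 / (2 * u)) = ennreal (1 / u)"
        using True by (subst ennreal_mult[symmetric]) auto
      finally show ?thesis
        using True by simp
    qed (auto simp: indicator_def)
  qed
  also have "\<dots> = (\<integral>\<^sup>+u. f (2 * u) * indicator {..<1/2} u \<partial>log_measure)"
    by (rule nn_integral_log_measure[symmetric]) measurable
  finally show ?thesis .
qed

section \<open>The K-functional and the interpolation spaces\<close>

lemma ennreal_mult_le_mult:
  assumes "0 \<le> a" "0 \<le> c" "a * b \<le> c * d"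
  shows "ennreal a * ennreal b \<le> ennreal c * ennreal d"
  using assms by (simp add: ennreal_leI flip: ennreal_mult')

section \<open>The K-functional of a general couple\<close>

lemma Kfun_le:
  assumes "g0 \<in> X0" "g1 \<in> X1" "\<And>x. x \<in> \<Omega> \<Longrightarrow> g x = g0 x + g1 x"
  shows "Kfun \<Omega> X0 N0 X1 N1 g t \<le> N0 g0 + ennreal t * N1 g1"
  unfolding Kfun_def using assms by (intro INF_lower2[of "(g0, g1)"]) auto

lemma Kfun_ge:
  assumes "\<And>g0 g1. g0 \<in> X0 \<Longrightarrow> g1 \<in> X1 \<Longrightarrow> (\<And>x. x \<in> \<Omega> \<Longrightarrow> g x = g0 x + g1 x) \<Longrightarrow> c \<le> N0 g0 + ennreal t * N1 g1"
  shows "c \<le> Kfun \<Omega> X0 N0 X1 N1 g t"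
  unfolding Kfun_def using assms by (intro INF_greatest) auto

text \<open>Holds on the whole line, since \<open>ennreal t\<close> is 0 for negative t; hence
  K(g,t) is Borel in t.\<close>

lemma mono_Kfun: "mono (Kfun \<Omega> X0 N0 X1 N1 g)"
proof (rule monoI)
  fix t t' :: real
  assume "t \<le> t'"
  then have "N0 g0 + ennreal t * N1 g1 \<le> N0 g0 + ennreal t' * N1 g1" for g0 g1
    by (intro add_left_mono mult_right_mono ennreal_leI) auto
  then show "Kfun \<Omega> X0 N0 X1 N1 g t \<le> Kfun \<Omega> X0 N0 X1 N1 g t'"
    by (intro Kfun_ge) (meson Kfun_le order.trans)
qed

text \<open>An infimum over an empty set of decompositions is \<open>top\<close>.\<close>

lemma Kfun_less_top_imp_sum_space:
  assumes "Kfun \<Omega> X0 N0 X1 N1 g t < top"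
  shows "g \<in> sum_space \<Omega> X0 X1"
  using assms by (auto simp: Kfun_def sum_space_def INF_less_iff)

lemma interp_norm_eq:
  "interp_norm \<Omega> X0 N0 X1 N1 \<theta> r g
     = epow (\<integral>\<^sup>+t. epow (ennreal (t powr - \<theta>) * Kfun \<Omega> X0 N0 X1 N1 g t) r \<partial>log_measure) (1 / r)"
proof -
  have [measurable]: "Kfun \<Omega> X0 N0 X1 N1 g \<in> borel_measurable borel"
    by (rule borel_measurable_mono_ennreal[OF mono_Kfun])
  show ?thesis
    unfolding interp_norm_def by (subst nn_integral_log_measure) simp_all
qed

section \<open>The couple of small Lebesgue spaces and its weights\<close>

locale small_leb_couple = unit_domain \<Omega> for \<Omega> :: "'a::euclidean_space set" +
  fixes p q \<alpha> \<theta> :: real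
  assumes p: "1 < p" and p_less_q: "p < q" and \<alpha>: "0 < \<alpha>" and \<theta>: "0 < \<theta>" "\<theta> < 1"
begin

abbreviation K :: "('a \<Rightarrow> real) \<Rightarrow> real \<Rightarrow> ennreal"
  where "K \<equiv> Kfun \<Omega> (small_leb \<Omega> p \<alpha>) (small_leb_norm \<Omega> p \<alpha>) (small_leb \<Omega> q \<alpha>) (small_leb_norm \<Omega> q \<alpha>)"

definition "\<delta> = 1 / p - 1 / q"

definition "x\<^sub>\<theta> = (1 - \<theta>) / p + \<theta> / q"

text \<open>The common currency of both sides: its L^r norm with respect to ds/s is the
  Lorentz-Zygmund norm.\<close>

definition k :: "('a \<Rightarrow> real) \<Rightarrow> real \<Rightarrow> ennreal"
  where "k g s = ennreal (phi \<alpha> x\<^sub>\<theta> s * decr g s)"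

lemma q: "1 < q"
  using p p_less_q by simp

lemma \<delta>: "0 < \<delta>"
  using p p_less_q by (simp add: \<delta>_def field_simps)

lemma x_bounds: "0 < x\<^sub>\<theta>" "x\<^sub>\<theta> < 1"
proof -
  have "(1 - \<theta>) / p + \<theta> / q < (1 - \<theta>) / 1 + \<theta> / 1"
    using p q \<theta> by (intro add_strict_mono divide_strict_left_mono) auto
  then show "0 < x\<^sub>\<theta>" "x\<^sub>\<theta> < 1"
    using p q \<theta> by (auto simp: x\<^sub>\<theta>_def add_pos_pos)
qed

text \<open>The point \<open>x\<^sub>\<theta>\<close> divides the segment from 1/p to 1/q in the
  ratio \<theta> to 1 - \<theta>. The factor rho^\<theta> found here is the one that t^(-\<theta>)
  cancels at t = rho(u).\<close>

lemma phi_p: "phi \<alpha> (1 / p) s = rho \<alpha> (\<delta> * \<theta>) s * phi \<alpha> x\<^sub>\<theta> s"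
proof -
  have "1 / p = x\<^sub>\<theta> + \<delta> * \<theta>"
    by (simp add: x\<^sub>\<theta>_def \<delta>_def diff_divide_distrib algebra_simps)
  then show ?thesis
    by (simp only: phi_add)
qed

lemma phi_x: "phi \<alpha> x\<^sub>\<theta> s = rho \<alpha> (\<delta> * (1 - \<theta>)) s * phi \<alpha> (1 / q) s"
proof -
  have "x\<^sub>\<theta> = 1 / q + \<delta> * (1 - \<theta>)"
    by (simp add: x\<^sub>\<theta>_def \<delta>_def diff_divide_distrib algebra_simps)
  then show ?thesis
    by (simp only: phi_add)
qed

lemma phi_p_q: "phi \<alpha> (1 / p) s = rho \<alpha> \<delta> s * phi \<alpha> (1 / q) s"
  using phi_add[of \<alpha> "1 / q" \<delta> s] by (simp add: \<delta>_def)

lemma rho_powr_minus: "rho \<alpha> \<delta> u powr - \<theta> = inverse (rho \<alpha> (\<delta> * \<theta>) u)"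
  by (simp add: rho_powr flip: rho_minus)

lemma measurable_k [measurable]: "meas_on \<Omega> g \<Longrightarrow> k g \<in> borel_measurable borel"
  unfolding k_def by measurable

text \<open>Both weak bounds are used at the same point u. The choice t = rho(u) turns the weight of
  the second space into that of the first, so the two terms recombine to a multiple of g0*(u) +
  g1*(u), which dominates g*(2u) for every decomposition.\<close>

lemma K_ge:
  obtains C where "0 < C"
    "\<And>g u. meas_on \<Omega> g \<Longrightarrow> 0 < u \<Longrightarrow> 2 * u < 1 \<Longrightarrow>
       k g (2 * u) \<le> ennreal C * (ennreal (rho \<alpha> \<delta> u powr - \<theta>) * K g (rho \<alpha> \<delta> u))"
proof -
  obtain c0 where c0: "0 < c0"
    "\<And>f u. meas_on \<Omega> f \<Longrightarrow> 0 < u \<Longrightarrow> u < 1 \<Longrightarrow>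
       ennreal (c0 * phi \<alpha> (1 / p) u * decr f u) \<le> small_leb_norm \<Omega> p \<alpha> f"
    by (rule small_leb_norm_ge[OF p \<alpha>]) blast
  obtain c1 where c1: "0 < c1"
    "\<And>f u. meas_on \<Omega> f \<Longrightarrow> 0 < u \<Longrightarrow> u < 1 \<Longrightarrow>
       ennreal (c1 * phi \<alpha> (1 / q) u * decr f u) \<le> small_leb_norm \<Omega> q \<alpha> f"
    by (rule small_leb_norm_ge[OF q \<alpha>]) blast
  define c where "c = min c0 c1"
  have c: "0 < c" "c \<le> c0" "c \<le> c1"
    using c0 c1 by (auto simp: c_def)
  have le: "k g (2 * u) \<le> ennreal (2 powr x\<^sub>\<theta> / c) * (ennreal (rho \<alpha> \<delta> u powr - \<theta>) * K g (rho \<alpha> \<delta> u))"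
    if g: "meas_on \<Omega> g" and u: "0 < u" "2 * u < 1" for g u
  proof -
    let ?R = "rho \<alpha> \<delta> u"
    have R: "0 < ?R" "0 < rho \<alpha> (\<delta> * \<theta>) u"
      using u by (auto intro!: rho_pos)
    have "ennreal (c * phi \<alpha> (1 / p) u * decr g (2 * u)) \<le> K g ?R"
    proof (rule Kfun_ge)
      fix g0 g1
      assume "g0 \<in> small_leb \<Omega> p \<alpha>" "g1 \<in> small_leb \<Omega> q \<alpha>"
        and sum: "\<And>x. x \<in> \<Omega> \<Longrightarrow> g x = g0 x + g1 x"
      then have m: "meas_on \<Omega> g0" "meas_on \<Omega> g1"
        by (auto simp: small_leb_def)
      have "decr g (2 * u) \<le> decr g0 u + decr g1 u"
        using u by (simp add: decr_eq rearr_add_le[OF g m u(1) sum])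
      then have "c * phi \<alpha> (1 / p) u * decr g (2 * u) \<le> c * phi \<alpha> (1 / p) u * (decr g0 u + decr g1 u)"
        using c by (intro mult_left_mono) (auto simp: phi_nonneg)
      also have "\<dots> = c * (phi \<alpha> (1 / p) u * decr g0 u) + ?R * (c * (phi \<alpha> (1 / q) u * decr g1 u))"
        by (simp add: phi_p_q algebra_simps)
      also have "\<dots> \<le> c0 * (phi \<alpha> (1 / p) u * decr g0 u) + ?R * (c1 * (phi \<alpha> (1 / q) u * decr g1 u))"
        using c R m by (intro add_mono mult_left_mono mult_right_mono) (auto simp: phi_nonneg decr_nonneg)
      finally have "ennreal (c * phi \<alpha> (1 / p) u * decr g (2 * u))
          \<le> ennreal (c0 * phi \<alpha> (1 / p) u * decr g0 u + ?R * (c1 * phi \<alpha> (1 / q) u * decr g1 u))"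
        by (intro ennreal_leI) (simp add: mult.assoc)
      also have "\<dots> = ennreal (c0 * phi \<alpha> (1 / p) u * decr g0 u) + ennreal ?R * ennreal (c1 * phi \<alpha> (1 / q) u * decr g1 u)"
        using R c0 c1 m by (simp add: phi_nonneg decr_nonneg ennreal_plus ennreal_mult)
      also have "\<dots> \<le> small_leb_norm \<Omega> p \<alpha> g0 + ennreal ?R * small_leb_norm \<Omega> q \<alpha> g1"
        using u m by (intro add_mono mult_left_mono c0 c1) auto
      finally show "ennreal (c * phi \<alpha> (1 / p) u * decr g (2 * u)) \<le> small_leb_norm \<Omega> p \<alpha> g0 + ennreal ?R * small_leb_norm \<Omega> q \<alpha> g1" .
    qed
    moreover have "k g (2 * u) \<le> ennreal (2 powr x\<^sub>\<theta> / c) * (ennreal (?R powr - \<theta>) * ennreal (c * phi \<alpha> (1 / p) u * decr g (2 * u)))"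
    proof -
      have "phi \<alpha> x\<^sub>\<theta> (2 * u) * decr g (2 * u) \<le> 2 powr x\<^sub>\<theta> * phi \<alpha> x\<^sub>\<theta> u * decr g (2 * u)"
        using u \<alpha> x_bounds g by (intro mult_right_mono phi_double_le) (auto simp: decr_nonneg)
      also have "\<dots> = 2 powr x\<^sub>\<theta> / c * (?R powr - \<theta> * (c * phi \<alpha> (1 / p) u * decr g (2 * u)))"
        using c R by (simp add: phi_p rho_powr_minus)
      finally have "k g (2 * u) \<le> ennreal (2 powr x\<^sub>\<theta> / c * (?R powr - \<theta> * (c * phi \<alpha> (1 / p) u * decr g (2 * u))))"
        unfolding k_def by (rule ennreal_leI)
      also have "\<dots> = ennreal (2 powr x\<^sub>\<theta> / c) * (ennreal (?R powr - \<theta>) * ennreal (c * phi \<alpha> (1 / p) u * decr g (2 * u)))"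
        using c by (subst ennreal_mult', simp, subst ennreal_mult') simp_all
      finally show ?thesis .
    qed
    ultimately show ?thesis
      by (meson mult_left_mono order.trans zero_le)
  qed
  show thesis
    using c by (intro that[OF _ le]) auto
qed

text \<open>The weight quotients decay at rate \<delta> \<theta> below the diagonal and \<delta> (1
  - \<theta>) above it; a symmetric kernel has to take the slower rate, which is positive for 0 <
  \<theta> < 1.\<close>

definition "b = \<delta> * min \<theta> (1 - \<theta>)"

lemma b: "0 < b" "b \<le> \<delta> * \<theta>" "b \<le> \<delta> * (1 - \<theta>)"
  using \<delta> \<theta> by (auto simp: b_def)

text \<open>By \<open>phi_p\<close> the left-hand side is (rho(s) / rho(u))^\<theta> k(s), and the
  quotient is at most (s/u)^\<delta>.\<close>

lemma weight_below:
  assumes "0 < s" "s \<le> u" "u \<le> 1" "meas_on \<Omega> g"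
  shows "ennreal (rho \<alpha> \<delta> u powr - \<theta>) * ennreal (phi \<alpha> (1 / p) s * decr g s) \<le> hardy_kernel b u s * k g s"
proof -
  have R: "0 < rho \<alpha> (\<delta> * \<theta>) u"
    using assms by (intro rho_pos) auto
  have "rho \<alpha> (\<delta> * \<theta>) s \<le> (s / u) powr (\<delta> * \<theta>) * rho \<alpha> (\<delta> * \<theta>) u"
    using assms \<alpha> \<delta> \<theta> by (intro rho_le) auto
  then have "rho \<alpha> \<delta> u powr - \<theta> * rho \<alpha> (\<delta> * \<theta>) s \<le> (s / u) powr (\<delta> * \<theta>)"
    using R by (simp add: rho_powr_minus field_simps)
  also have "\<dots> \<le> (s / u) powr b"
    using assms b by (intro powr_mono') auto
  also have "\<dots> = min (s / u) (u / s) powr b"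
  proof -
    have "s / u \<le> 1" "1 \<le> u / s"
      using assms by auto
    then show ?thesis by simp
  qed
  finally have "rho \<alpha> \<delta> u powr - \<theta> * rho \<alpha> (\<delta> * \<theta>) s * (phi \<alpha> x\<^sub>\<theta> s * decr g s)
      \<le> min (s / u) (u / s) powr b * (phi \<alpha> x\<^sub>\<theta> s * decr g s)"
    using assms by (intro mult_right_mono) (auto simp: phi_nonneg decr_nonneg)
  then show ?thesis
    unfolding hardy_kernel_def k_def phi_p
    by (intro ennreal_mult_le_mult) (simp_all add: mult.assoc)
qed

text \<open>By \<open>phi_x\<close> the left-hand side is (rho(u) / rho(s))^(1-\<theta>) k(s), the
  mirror image of \<open>weight_below\<close>.\<close>

lemma weight_above:
  assumes "0 < u" "u \<le> s" "s \<le> 1" "meas_on \<Omega> g"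
  shows "ennreal (rho \<alpha> \<delta> u powr (1 - \<theta>)) * ennreal (phi \<alpha> (1 / q) s * decr g s) \<le> hardy_kernel b u s * k g s"
proof -
  have "rho \<alpha> \<delta> u powr (1 - \<theta>) \<le> (u / s) powr (\<delta> * (1 - \<theta>)) * rho \<alpha> (\<delta> * (1 - \<theta>)) s"
    using assms \<alpha> \<delta> \<theta> unfolding rho_powr by (intro rho_le) auto
  also have "\<dots> \<le> (u / s) powr b * rho \<alpha> (\<delta> * (1 - \<theta>)) s"
    using assms b rho_pos[of s \<alpha> "\<delta> * (1 - \<theta>)"] by (intro mult_right_mono powr_mono') auto
  also have "(u / s) powr b = min (s / u) (u / s) powr b"
  proof -
    have "u / s \<le> 1" "1 \<le> s / u"
      using assms by auto
    then show ?thesis by simp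
  qed
  finally have "rho \<alpha> \<delta> u powr (1 - \<theta>) * (phi \<alpha> (1 / q) s * decr g s)
      \<le> min (s / u) (u / s) powr b * rho \<alpha> (\<delta> * (1 - \<theta>)) s * (phi \<alpha> (1 / q) s * decr g s)"
    using assms by (intro mult_right_mono) (auto simp: phi_nonneg decr_nonneg)
  then show ?thesis
    unfolding hardy_kernel_def k_def phi_x
    by (intro ennreal_mult_le_mult) (simp_all add: mult.assoc)
qed

text \<open>Truncation at height g*(u) sends to the first space a function whose rearrangement
  vanishes from u on, and to the second one bounded by g*(u). The Lorentz bounds then see g* only on
  (0,u) with the first weight and on (u,1) with the second; these two pieces form the Hardy
  integral, and the flat piece on (0,u) gives the extra term k(u).\<close>

lemma K_le:
  obtains C where "0 < C"
    "\<And>g u. meas_on \<Omega> g \<Longrightarrow> 0 < u \<Longrightarrow> u < 1 \<Longrightarrow>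
       ennreal (rho \<alpha> \<delta> u powr - \<theta>) * K g (rho \<alpha> \<delta> u)
         \<le> ennreal C * ((\<integral>\<^sup>+s. hardy_kernel b u s * k g s \<partial>log_measure) + k g u)"
proof -
  define c0 where "c0 = 1 / (\<alpha> * (1 - 1 / p))"
  define c1 where "c1 = 1 / (\<alpha> * (1 - 1 / q))"
  have c: "0 < c0" "0 < c1"
    using \<alpha> p q by (auto simp: c0_def c1_def field_simps)
  obtain c2 where c2: "0 < c2" "\<And>u. 0 < u \<Longrightarrow> u < 1 \<Longrightarrow>
      (\<integral>\<^sup>+s. ennreal (phi \<alpha> (1 / q) s) * indicator {..<u} s \<partial>log_measure) \<le> ennreal (c2 * phi \<alpha> (1 / q) u)"
    by (rule nn_integral_phi_le[of "1 / q" \<alpha>]) (use q \<alpha> in auto)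
  define C where "C = c0 + c1 + c1 * c2"
  have le: "ennreal (rho \<alpha> \<delta> u powr - \<theta>) * K g (rho \<alpha> \<delta> u)
         \<le> ennreal C * ((\<integral>\<^sup>+s. hardy_kernel b u s * k g s \<partial>log_measure) + k g u)"
    if g: "meas_on \<Omega> g" and u: "0 < u" "u < 1" for g u
  proof -
    have [measurable]: "decr g \<in> borel_measurable borel" "(\<lambda>x. indicator \<Omega> x * g x) \<in> borel_measurable lebesgue"
      using g by (auto simp: meas_on_iff)
    let ?I = "\<integral>\<^sup>+s. hardy_kernel b u s * k g s \<partial>log_measure"
    let ?R = "rho \<alpha> \<delta> u"
    have R: "0 < ?R"
      using u by (auto intro!: rho_pos)
    define l where "l = decr g u"
    have l: "0 \<le> l" "l = rearr \<Omega> g u"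
      using g u by (auto simp: l_def decr_eq rearr_nonneg)
    \<comment> \<open>Clamping to [-l, l] keeps |g1| below both l and |g|, and the excess g0
      vanishes where |g| \<le> l.\<close>
    define g1 where "g1 x = max (- l) (min l (g x))" for x
    define g0 where "g0 x = g x - g1 x" for x
    \<comment> \<open>As l \<ge> 0, the clamp fixes 0 and so commutes with the cut-off to
      \<Omega>.\<close>
    have "(\<lambda>x. indicator \<Omega> x * g1 x) = (\<lambda>x. max (- l) (min l (indicator \<Omega> x * g x)))"
      using l by (auto simp: g1_def indicator_def)
    then have meas1: "meas_on \<Omega> g1"
      unfolding meas_on_iff by simp
    have "(\<lambda>x. indicator \<Omega> x * g0 x) = (\<lambda>x. indicator \<Omega> x * g x - indicator \<Omega> x * g1 x)"
      by (auto simp: g0_def algebra_simps)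
    then have meas0: "meas_on \<Omega> g0"
      using meas1 unfolding meas_on_iff by simp
    have [measurable]: "decr g0 \<in> borel_measurable borel" "decr g1 \<in> borel_measurable borel"
      using meas0 meas1 by auto
    have g0_below: "decr g0 s \<le> decr g s" if "0 < s" for s
      using that g meas0 l(1) by (simp add: decr_eq) (rule rearr_mono, auto simp: g0_def g1_def)
    have g0_above: "decr g0 s = 0" if "u \<le> s" for s
      using that u g meas0 l by (simp add: decr_eq) (rule rearr_eq_0[of _ g u], auto simp: g0_def g1_def)
    have g1_below: "decr g1 s \<le> l" if "0 < s" for s
      using that meas1 l(1) by (simp add: decr_eq) (rule rearr_le_bound, auto simp: g1_def)
    have g1_above: "decr g1 s \<le> decr g s" if "0 < s" for s
      using that g meas1 l(1) by (simp add: decr_eq) (rule rearr_mono, auto simp: g1_def)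
    define A where "A = (\<integral>\<^sup>+s. ennreal (phi \<alpha> (1 / p) s * decr g s) * indicator {..<u} s \<partial>log_measure)"
    define B where "B = (\<integral>\<^sup>+s. ennreal (phi \<alpha> (1 / q) s * decr g s) * indicator {u..} s \<partial>log_measure)"
    have N0: "small_leb_norm \<Omega> p \<alpha> g0 \<le> ennreal c0 * A"
    proof -
      have "(\<integral>\<^sup>+s. ennreal (phi \<alpha> (1 / p) s * decr g0 s) \<partial>log_measure) \<le> A"
        unfolding A_def using g0_below g0_above
        by (intro nn_integral_log_measure_mono)
          (auto simp: indicator_def phi_nonneg intro!: ennreal_leI mult_left_mono)
      then show ?thesis
        using small_leb_norm_le[OF p \<alpha> meas0] unfolding c0_def
        by (meson mult_left_mono order.trans zero_le)
    qed
    have N1: "small_leb_norm \<Omega> q \<alpha> g1 \<le> ennreal c1 * (ennreal (c2 * phi \<alpha> (1 / q) u * l) + B)"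
    proof -
      have "(\<integral>\<^sup>+s. ennreal (phi \<alpha> (1 / q) s * decr g1 s) \<partial>log_measure)
         \<le> (\<integral>\<^sup>+s. ennreal (phi \<alpha> (1 / q) s) * indicator {..<u} s * ennreal l
               + ennreal (phi \<alpha> (1 / q) s * decr g s) * indicator {u..} s \<partial>log_measure)"
        using g1_below g1_above l
        by (intro nn_integral_log_measure_mono)
          (auto simp: indicator_def phi_nonneg intro!: ennreal_leI mult_left_mono simp flip: ennreal_mult)
      also have "\<dots> = (\<integral>\<^sup>+s. ennreal (phi \<alpha> (1 / q) s) * indicator {..<u} s \<partial>log_measure) * ennreal l + B"
        unfolding B_def by (subst nn_integral_add) (simp_all add: nn_integral_multc)
      also have "\<dots> \<le> ennreal (c2 * phi \<alpha> (1 / q) u) * ennreal l + B"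
        using c2 u by (intro add_mono mult_right_mono) auto
      also have "\<dots> = ennreal (c2 * phi \<alpha> (1 / q) u * l) + B"
        using c2 l by (simp add: ennreal_mult phi_nonneg)
      finally have "(\<integral>\<^sup>+s. ennreal (phi \<alpha> (1 / q) s * decr g1 s) \<partial>log_measure) \<le> ennreal (c2 * phi \<alpha> (1 / q) u * l) + B" .
      then show ?thesis
        using small_leb_norm_le[OF q \<alpha> meas1] unfolding c1_def
        by (meson mult_left_mono order.trans zero_le)
    qed
    have A_le: "ennreal (?R powr - \<theta>) * A \<le> ?I"
    proof -
      have "ennreal (?R powr - \<theta>) * A = (\<integral>\<^sup>+s. ennreal (?R powr - \<theta>) * (ennreal (phi \<alpha> (1 / p) s * decr g s) * indicator {..<u} s) \<partial>log_measure)"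
        unfolding A_def by (rule nn_integral_cmult[symmetric]) measurable
      also have "\<dots> \<le> ?I"
        using u g by (intro nn_integral_log_measure_mono) (auto simp: indicator_def intro: weight_below)
      finally show ?thesis .
    qed
    have B_le: "ennreal (?R powr (1 - \<theta>)) * B \<le> ?I"
    proof -
      have "ennreal (?R powr (1 - \<theta>)) * B = (\<integral>\<^sup>+s. ennreal (?R powr (1 - \<theta>)) * (ennreal (phi \<alpha> (1 / q) s * decr g s) * indicator {u..} s) \<partial>log_measure)"
        unfolding B_def by (rule nn_integral_cmult[symmetric]) measurable
      also have "\<dots> \<le> ?I"
        using u g by (intro nn_integral_log_measure_mono) (auto simp: indicator_def intro: weight_above)
      finally show ?thesis .
    qed
    \<comment> \<open>By \<open>phi_x\<close> the remaining power of rho is just what turns the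
      weight of the second space at u into the target weight.\<close>
    have k_eq: "ennreal (?R powr (1 - \<theta>)) * ennreal (c2 * phi \<alpha> (1 / q) u * l) = ennreal c2 * k g u"
    proof -
      have "ennreal (?R powr (1 - \<theta>)) * ennreal (c2 * phi \<alpha> (1 / q) u * l) = ennreal (?R powr (1 - \<theta>) * (c2 * phi \<alpha> (1 / q) u * l))"
        by (rule ennreal_mult'[symmetric]) simp
      also have "?R powr (1 - \<theta>) * (c2 * phi \<alpha> (1 / q) u * l) = c2 * (phi \<alpha> x\<^sub>\<theta> u * decr g u)"
        by (simp add: phi_x rho_powr l_def)
      also have "ennreal \<dots> = ennreal c2 * k g u"
        unfolding k_def using c2(1) by (intro ennreal_mult') auto
      finally show ?thesis .
    qed
    show ?thesis
    \<comment> \<open>If the Hardy integral is infinite the bound is trivial. Otherwise A and B are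
      finite, so g0 and g1 really belong to the two spaces and form an admissible
      decomposition.\<close>
    proof (cases "?I = top")
      case True
      then show ?thesis
        using c c2 by (simp add: C_def ennreal_mult_top ennreal_top_mult add_pos_pos)
    next
      case False
      then have "ennreal (?R powr - \<theta>) * A < top" "ennreal (?R powr (1 - \<theta>)) * B < top"
        using A_le B_le by (auto simp: less_top intro: order.strict_trans1)
      then have fin: "A < top" "B < top"
        using R by (auto simp: ennreal_mult_less_top ennreal_eq_0_iff)
      have "g0 \<in> small_leb \<Omega> p \<alpha>"
        unfolding small_leb_def using meas0 N0 fin
        by (auto simp: ennreal_mult_less_top intro: order.strict_trans1)
      moreover have "g1 \<in> small_leb \<Omega> q \<alpha>"
        unfolding small_leb_def using meas1 N1 fin
        by (auto simp: ennreal_mult_less_top intro: order.strict_trans1)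
      ultimately have "K g ?R \<le> small_leb_norm \<Omega> p \<alpha> g0 + ennreal ?R * small_leb_norm \<Omega> q \<alpha> g1"
        by (rule Kfun_le) (simp add: g0_def)
      also have "\<dots> \<le> ennreal c0 * A + ennreal ?R * (ennreal c1 * (ennreal (c2 * phi \<alpha> (1 / q) u * l) + B))"
        using N0 N1 by (intro add_mono mult_left_mono) auto
      finally have "ennreal (?R powr - \<theta>) * K g ?R
          \<le> ennreal (?R powr - \<theta>) * (ennreal c0 * A + ennreal ?R * (ennreal c1 * (ennreal (c2 * phi \<alpha> (1 / q) u * l) + B)))"
        by (rule mult_left_mono) simp
      also have "\<dots> = ennreal c0 * (ennreal (?R powr - \<theta>) * A)
          + ennreal c1 * ((ennreal (?R powr - \<theta>) * ennreal ?R) * ennreal (c2 * phi \<alpha> (1 / q) u * l)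
             + (ennreal (?R powr - \<theta>) * ennreal ?R) * B)"
        by (simp only: distrib_left mult_ac)
      also have "ennreal (?R powr - \<theta>) * ennreal ?R = ennreal (?R powr (1 - \<theta>))"
        using R by (simp add: powr_diff powr_minus field_simps flip: ennreal_mult)
      also have "ennreal c0 * (ennreal (?R powr - \<theta>) * A)
          + ennreal c1 * (ennreal (?R powr (1 - \<theta>)) * ennreal (c2 * phi \<alpha> (1 / q) u * l) + ennreal (?R powr (1 - \<theta>)) * B)
        \<le> ennreal c0 * ?I + ennreal c1 * (ennreal c2 * k g u + ?I)"
        unfolding k_eq using A_le B_le by (intro add_mono mult_left_mono) auto
      also have "\<dots> = ennreal (c0 + c1) * ?I + ennreal (c1 * c2) * k g u"
        using c c2 by (simp add: ennreal_plus ennreal_mult distrib_left distrib_right mult_ac add_ac)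
      also have "\<dots> \<le> ennreal C * ?I + ennreal C * k g u"
        using c c2 by (intro add_mono mult_right_mono ennreal_leI) (auto simp: C_def)
      finally show ?thesis
        by (simp add: distrib_left)
    qed
  qed
  show thesis
    using c c2 by (intro that[OF _ le]) (auto simp: C_def add_pos_pos)
qed

section \<open>Comparison of the two integrals\<close>

definition lz_integral :: "real \<Rightarrow> ('a \<Rightarrow> real) \<Rightarrow> ennreal"
  where "lz_integral r g = (\<integral>\<^sup>+s. epow (k g s) r \<partial>log_measure)"

definition interp_integral :: "real \<Rightarrow> ('a \<Rightarrow> real) \<Rightarrow> ennreal"
  where "interp_integral r g = (\<integral>\<^sup>+t. epow (ennreal (t powr - \<theta>) * K g t) r \<partial>log_measure)"

lemma measurable_interp_integrand [measurable]:
  "(\<lambda>t. epow (ennreal (t powr - \<theta>) * K g t) r) \<in> borel_measurable borel"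
proof -
  have [measurable]: "K g \<in> borel_measurable borel"
    by (rule borel_measurable_mono_ennreal[OF mono_Kfun])
  show ?thesis by measurable
qed

text \<open>The pointwise bound \<open>K_le\<close> is raised to the power r and integrated, with
  the Hardy inequality absorbing the integral term. Since 1 - ln u \<ge> 1, the Jacobian is at most
  \<delta> (1 + \<alpha>).\<close>

lemma interp_integral_le:
  assumes r: "1 < r"
  obtains C where "0 < C" "\<And>g. meas_on \<Omega> g \<Longrightarrow> interp_integral r g \<le> ennreal C * lz_integral r g"
proof -
  interpret L: sigma_finite_measure log_measure
    by (rule sigma_finite_log_measure)
  obtain C where C: "0 < C"
    "\<And>g u. meas_on \<Omega> g \<Longrightarrow> 0 < u \<Longrightarrow> u < 1 \<Longrightarrow>
       ennreal (rho \<alpha> \<delta> u powr - \<theta>) * K g (rho \<alpha> \<delta> u)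
         \<le> ennreal C * ((\<integral>\<^sup>+s. hardy_kernel b u s * k g s \<partial>log_measure) + k g u)"
    by (rule K_le) blast
  define c where "c = C powr r * 2 powr r * (\<delta> * (1 + \<alpha>))"
  have c: "0 < c"
    using C \<delta> \<alpha> by (simp add: c_def)
  have le: "interp_integral r g \<le> ennreal (c * ((4 / b) powr r + 1)) * lz_integral r g" if g: "meas_on \<Omega> g" for g
  proof -
    have [measurable]: "k g \<in> borel_measurable borel"
      using g by measurable
    let ?I = "\<lambda>u. \<integral>\<^sup>+s. hardy_kernel b u s * k g s \<partial>log_measure"
    have [measurable]: "?I \<in> borel_measurable borel"
      unfolding hardy_kernel_def by measurable
    have "interp_integral r g = (\<integral>\<^sup>+u. epow (ennreal (rho \<alpha> \<delta> u powr - \<theta>) * K g (rho \<alpha> \<delta> u)) r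
        * ennreal (\<delta> * (1 + \<alpha> / (1 - ln u))) \<partial>log_measure)"
      unfolding interp_integral_def using \<delta> \<alpha> by (intro nn_integral_rho_substitution) auto
    also have "\<dots> \<le> (\<integral>\<^sup>+u. ennreal c * (epow (?I u) r + epow (k g u) r) \<partial>log_measure)"
    proof (rule nn_integral_log_measure_mono)
      fix u :: real
      assume u: "0 < u" "u < 1"
      have "epow (ennreal (rho \<alpha> \<delta> u powr - \<theta>) * K g (rho \<alpha> \<delta> u)) r \<le> epow (ennreal C * (?I u + k g u)) r"
        using r C(2)[OF g u] by (intro epow_mono) auto
      also have "\<dots> = ennreal (C powr r) * epow (?I u + k g u) r"
        using C by (simp add: epow_mult epow_ennreal)
      also have "\<dots> \<le> ennreal (C powr r) * (ennreal (2 powr r) * (epow (?I u) r + epow (k g u) r))"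
        using r by (intro mult_left_mono epow_add_le) auto
      finally have "epow (ennreal (rho \<alpha> \<delta> u powr - \<theta>) * K g (rho \<alpha> \<delta> u)) r
          \<le> ennreal (C powr r * 2 powr r) * (epow (?I u) r + epow (k g u) r)"
        by (simp add: ennreal_mult mult.assoc)
      moreover have "\<delta> * (1 + \<alpha> / (1 - ln u)) \<le> \<delta> * (1 + \<alpha>)"
      proof -
        have "\<alpha> / (1 - ln u) \<le> \<alpha> / 1"
          using u \<alpha> ln_less_1[of u] by (intro divide_left_mono) auto
        then show ?thesis
          using \<delta> by (intro mult_left_mono) auto
      qed
      ultimately have "epow (ennreal (rho \<alpha> \<delta> u powr - \<theta>) * K g (rho \<alpha> \<delta> u)) r * ennreal (\<delta> * (1 + \<alpha> / (1 - ln u)))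
          \<le> ennreal (C powr r * 2 powr r) * (epow (?I u) r + epow (k g u) r) * ennreal (\<delta> * (1 + \<alpha>))"
        by (rule mult_mono[OF _ ennreal_leI]) auto
      also have "\<dots> = ennreal c * (epow (?I u) r + epow (k g u) r)"
        using \<delta> \<alpha> by (simp add: c_def ennreal_mult mult_ac)
      finally show "epow (ennreal (rho \<alpha> \<delta> u powr - \<theta>) * K g (rho \<alpha> \<delta> u)) r * ennreal (\<delta> * (1 + \<alpha> / (1 - ln u)))
          \<le> ennreal c * (epow (?I u) r + epow (k g u) r)" .
    qed
    also have "\<dots> = ennreal c * ((\<integral>\<^sup>+u. epow (?I u) r \<partial>log_measure) + lz_integral r g)"
      unfolding lz_integral_def by (simp add: nn_integral_cmult nn_integral_add)
    also have "\<dots> \<le> ennreal c * (ennreal ((4 / b) powr r) * lz_integral r g + lz_integral r g)"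
      unfolding lz_integral_def using b r by (intro mult_left_mono add_right_mono hardy_inequality) auto
    also have "\<dots> = ennreal (c * ((4 / b) powr r + 1)) * lz_integral r g"
      using c by (simp add: ennreal_mult ennreal_plus distrib_left distrib_right mult.assoc)
    finally show ?thesis .
  qed
  show thesis
    using c by (intro that[OF _ le]) (auto intro!: mult_pos_pos add_nonneg_pos)
qed

text \<open>Here \<open>K_ge\<close> is pointwise up to a dilation by 2, which leaves ds/s
  invariant; the Jacobian is needed from below, where it is at least \<delta>.\<close>

lemma lz_integral_le:
  assumes r: "1 < r"
  obtains C where "0 < C" "\<And>g. meas_on \<Omega> g \<Longrightarrow> lz_integral r g \<le> ennreal C * interp_integral r g"
proof -
  obtain C where C: "0 < C"
    "\<And>g u. meas_on \<Omega> g \<Longrightarrow> 0 < u \<Longrightarrow> 2 * u < 1 \<Longrightarrow>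
       k g (2 * u) \<le> ennreal C * (ennreal (rho \<alpha> \<delta> u powr - \<theta>) * K g (rho \<alpha> \<delta> u))"
    by (rule K_ge) blast
  have le: "lz_integral r g \<le> ennreal (C powr r / \<delta>) * interp_integral r g" if g: "meas_on \<Omega> g" for g
  proof -
    have [measurable]: "k g \<in> borel_measurable borel"
      using g by measurable
    let ?F = "\<lambda>u. epow (ennreal (rho \<alpha> \<delta> u powr - \<theta>) * K g (rho \<alpha> \<delta> u)) r"
    let ?G = "\<lambda>u. ?F u * ennreal (\<delta> * (1 + \<alpha> / (1 - ln u)))"
    have "lz_integral r g = (\<integral>\<^sup>+u. epow (k g (2 * u)) r * indicator {..<1/2} u \<partial>log_measure)"
      unfolding lz_integral_def by (rule nn_integral_log_measure_double) measurable
    also have "\<dots> \<le> (\<integral>\<^sup>+u. ennreal (C powr r / \<delta>) * ?G u \<partial>log_measure)"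
    proof (rule nn_integral_log_measure_mono)
      fix u :: real
      assume u: "0 < u" "u < 1"
      show "epow (k g (2 * u)) r * indicator {..<1/2} u \<le> ennreal (C powr r / \<delta>) * ?G u"
      proof (cases "2 * u < 1")
        case True
        have "epow (k g (2 * u)) r \<le> epow (ennreal C * (ennreal (rho \<alpha> \<delta> u powr - \<theta>) * K g (rho \<alpha> \<delta> u))) r"
          using r C(2)[OF g u(1) True] by (intro epow_mono) auto
        also have "\<dots> = ennreal (C powr r) * ?F u"
          using C(1) by (simp add: epow_mult epow_ennreal)
        \<comment> \<open>A factor \<delta> is split off to make room for the Jacobian, which
          dominates it.\<close>
        also have "\<dots> = ennreal (C powr r / \<delta>) * (?F u * ennreal \<delta>)"
        proof -
          have "ennreal (C powr r) = ennreal (C powr r / \<delta>) * ennreal \<delta>"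
            using \<delta> by (simp flip: ennreal_mult)
          then show ?thesis
            by (simp only: mult_ac)
        qed
        also have "\<dots> \<le> ennreal (C powr r / \<delta>) * ?G u"
          using u \<delta> \<alpha> ln_less_1[of u] by (intro mult_left_mono ennreal_leI) auto
        finally show ?thesis
          using True by simp
      qed (simp add: indicator_def)
    qed
    also have "\<dots> = ennreal (C powr r / \<delta>) * (\<integral>\<^sup>+u. ?G u \<partial>log_measure)"
    proof (rule nn_integral_cmult)
      have [measurable]: "K g \<in> borel_measurable borel"
        by (rule borel_measurable_mono_ennreal[OF mono_Kfun])
      show "?G \<in> borel_measurable log_measure"
        by measurable
    qed
    also have "(\<integral>\<^sup>+u. ?G u \<partial>log_measure) = interp_integral r g"
      unfolding interp_integral_def using \<delta> \<alpha> by (intro nn_integral_rho_substitution[symmetric]) auto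
    finally show ?thesis .
  qed
  show thesis
    using C \<delta> by (intro that[OF _ le]) auto
qed

section \<open>From integrals to norms and spaces\<close>

abbreviation interp :: "real \<Rightarrow> ('a \<Rightarrow> real) \<Rightarrow> ennreal"
  where "interp r \<equiv> interp_norm \<Omega> (small_leb \<Omega> p \<alpha>) (small_leb_norm \<Omega> p \<alpha>)
           (small_leb \<Omega> q \<alpha>) (small_leb_norm \<Omega> q \<alpha>) \<theta> r"

lemma interp_norm_eq_integral: "interp r g = epow (interp_integral r g) (1 / r)"
  by (simp add: interp_norm_eq interp_integral_def)

text \<open>\<open>k\<close> is built from \<open>decr\<close>, which agrees with
  \<open>rearr\<close> on (0,1), the only range the norm sees.\<close>

lemma lz_norm_eq_integral:
  assumes g: "meas_on \<Omega> g" and a: "1 / a = x\<^sub>\<theta>" and \<beta>: "\<beta> = \<alpha> * (1 - x\<^sub>\<theta>)"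
  shows "lz_norm \<Omega> a r \<beta> g = epow (lz_integral r g) (1 / r)"
proof -
  have [measurable]: "k g \<in> borel_measurable borel"
    using g by measurable
  have "(\<integral>\<^sup>+t\<in>{0<..<1}. ennreal ((t powr (1 / a) * (1 - ln t) powr \<beta> * rearr \<Omega> g t) powr r * (1 / t)) \<partial>lborel)
     = (\<integral>\<^sup>+t\<in>{0<..<1}. epow (k g t) r * ennreal (1 / t) \<partial>lborel)"
  proof (rule nn_integral_cong)
    fix t :: real
    have "ennreal ((phi \<alpha> x\<^sub>\<theta> t * decr g t) powr r * (1 / t)) = epow (k g t) r * ennreal (1 / t)" if "0 < t"
      using that g by (subst ennreal_mult) (auto simp: k_def epow_ennreal phi_nonneg decr_nonneg)
    then show "ennreal ((t powr (1 / a) * (1 - ln t) powr \<beta> * rearr \<Omega> g t) powr r * (1 / t)) * indicator {0<..<1} t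
        = epow (k g t) r * ennreal (1 / t) * indicator {0<..<1} t"
      unfolding a \<beta> by (auto simp: indicator_def phi_def decr_eq)
  qed
  also have "\<dots> = lz_integral r g"
    unfolding lz_integral_def by (rule nn_integral_log_measure[symmetric]) measurable
  finally show ?thesis
    by (simp add: lz_norm_def)
qed

lemma sum_space_meas_on:
  assumes "g \<in> sum_space \<Omega> (small_leb \<Omega> p \<alpha>) (small_leb \<Omega> q \<alpha>)"
  shows "meas_on \<Omega> g"
proof -
  obtain g0 g1 where "meas_on \<Omega> g0" "meas_on \<Omega> g1" and sum: "\<forall>x\<in>\<Omega>. g x = g0 x + g1 x"
    using assms by (auto simp: sum_space_def small_leb_def)
  then have "(\<lambda>x. indicator \<Omega> x * g0 x + indicator \<Omega> x * g1 x) \<in> borel_measurable lebesgue"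
    by (simp add: meas_on_iff)
  also have "(\<lambda>x. indicator \<Omega> x * g0 x + indicator \<Omega> x * g1 x) = (\<lambda>x. indicator \<Omega> x * g x)"
    using sum by (auto simp: indicator_def)
  finally show ?thesis
    by (simp add: meas_on_iff)
qed

text \<open>Outside the sum space K(g,t) is \<open>top\<close> for every t, and so is its integral
  against a nonzero measure. Thus a finite norm already implies the membership that
  \<open>interp_space\<close> asks for.\<close>

lemma interp_less_top_imp_sum_space:
  assumes "interp r g < top" and r: "1 < r"
  shows "g \<in> sum_space \<Omega> (small_leb \<Omega> p \<alpha>) (small_leb \<Omega> q \<alpha>)"
proof (rule ccontr)
  assume notin: "g \<notin> sum_space \<Omega> (small_leb \<Omega> p \<alpha>) (small_leb \<Omega> q \<alpha>)"
  have top: "K g t = top" for t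
  proof (rule ccontr)
    assume "K g t \<noteq> top"
    then have "K g t < top"
      by (simp only: less_top)
    from notin Kfun_less_top_imp_sum_space[OF this] show False
      by (rule notE)
  qed
  have "AE t in log_measure. epow (ennreal (t powr - \<theta>) * K g t) r = top"
    using AE_log_measure
  proof eventually_elim
    case (elim t)
    then have "0 < t powr - \<theta>"
      by simp
    then have "ennreal (t powr - \<theta>) \<noteq> 0"
      unfolding ennreal_eq_0_iff by linarith
    then show ?case
      by (simp only: top ennreal_mult_top epow_top if_False)
  qed
  then have "interp_integral r g = (\<integral>\<^sup>+t. top \<partial>log_measure)"
    unfolding interp_integral_def by (rule nn_integral_cong_AE)
  also have "\<dots> = top"
  proof -
    \<comment> \<open>The integral of t with respect to dt/t over (0,1) equals 1, which rules out a
      null measure.\<close>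
    have "ennreal (1 / 1) = (\<integral>\<^sup>+t. ennreal ((t / 1) powr 1) * indicator {..<1} t \<partial>log_measure)"
      by (rule nn_integral_log_measure_less[symmetric]) auto
    also have "\<dots> \<le> (\<integral>\<^sup>+t. 1 \<partial>log_measure)"
      by (intro nn_integral_log_measure_mono) (auto simp: indicator_def)
    finally have "emeasure log_measure UNIV \<noteq> 0"
      by auto
    then show ?thesis
      by (simp add: ennreal_top_mult)
  qed
  finally show False
    using assms by (simp add: interp_norm_eq_integral)
qed

text \<open>The norm bounds hold for all measurable g, with \<open>top\<close> allowed as a value,
  so finiteness passes in both directions. Measurability of members of the interpolation space comes
  from their decomposition in the sum space.\<close>

lemma interp_space_eq_lz_space:
  assumes r: "1 < r" and a: "1 / a = x\<^sub>\<theta>" and \<beta>: "\<beta> = \<alpha> * (1 - x\<^sub>\<theta>)"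
  shows "interp_space \<Omega> (small_leb \<Omega> p \<alpha>) (small_leb_norm \<Omega> p \<alpha>)
            (small_leb \<Omega> q \<alpha>) (small_leb_norm \<Omega> q \<alpha>) \<theta> r = lz_space \<Omega> a r \<beta>"
    and "\<exists>C>0. \<forall>g \<in> lz_space \<Omega> a r \<beta>.
       interp r g \<le> ennreal C * lz_norm \<Omega> a r \<beta> g \<and> lz_norm \<Omega> a r \<beta> g \<le> ennreal C * interp r g"
proof -
  obtain C1 where C1: "0 < C1" "\<And>g. meas_on \<Omega> g \<Longrightarrow> interp_integral r g \<le> ennreal C1 * lz_integral r g"
    by (rule interp_integral_le[OF r]) blast
  obtain C2 where C2: "0 < C2" "\<And>g. meas_on \<Omega> g \<Longrightarrow> lz_integral r g \<le> ennreal C2 * interp_integral r g"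
    by (rule lz_integral_le[OF r]) blast
  define C where "C = max (C1 powr (1 / r)) (C2 powr (1 / r))"
  have C: "0 < C"
    using C1 by (auto simp: C_def less_max_iff_disj)
  have 1: "interp r g \<le> ennreal C * lz_norm \<Omega> a r \<beta> g" if g: "meas_on \<Omega> g" for g
  proof -
    have "interp r g \<le> ennreal (C1 powr (1 / r)) * lz_norm \<Omega> a r \<beta> g"
      unfolding interp_norm_eq_integral lz_norm_eq_integral[OF g a \<beta>]
      using r C1 g by (intro epow_root_le) auto
    also have "\<dots> \<le> ennreal C * lz_norm \<Omega> a r \<beta> g"
      by (intro mult_right_mono ennreal_leI) (auto simp: C_def)
    finally show ?thesis .
  qed
  have 2: "lz_norm \<Omega> a r \<beta> g \<le> ennreal C * interp r g" if g: "meas_on \<Omega> g" for g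
  proof -
    have "lz_norm \<Omega> a r \<beta> g \<le> ennreal (C2 powr (1 / r)) * interp r g"
      unfolding interp_norm_eq_integral lz_norm_eq_integral[OF g a \<beta>]
      using r C2 g by (intro epow_root_le) auto
    also have "\<dots> \<le> ennreal C * interp r g"
      by (intro mult_right_mono ennreal_leI) (auto simp: C_def)
    finally show ?thesis .
  qed
  show "interp_space \<Omega> (small_leb \<Omega> p \<alpha>) (small_leb_norm \<Omega> p \<alpha>)
            (small_leb \<Omega> q \<alpha>) (small_leb_norm \<Omega> q \<alpha>) \<theta> r = lz_space \<Omega> a r \<beta>"
  proof (intro equalityI subsetI)
    fix g
    assume "g \<in> interp_space \<Omega> (small_leb \<Omega> p \<alpha>) (small_leb_norm \<Omega> p \<alpha>)
            (small_leb \<Omega> q \<alpha>) (small_leb_norm \<Omega> q \<alpha>) \<theta> r"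
    then have g: "meas_on \<Omega> g" "interp r g < top"
      by (auto simp: interp_space_def sum_space_meas_on)
    then have "ennreal C * interp r g < top"
      by (simp add: ennreal_mult_less_top)
    then show "g \<in> lz_space \<Omega> a r \<beta>"
      using g 2[OF g(1)] by (auto simp: lz_space_def intro: order.strict_trans1)
  next
    fix g
    assume "g \<in> lz_space \<Omega> a r \<beta>"
    then have g: "meas_on \<Omega> g" "lz_norm \<Omega> a r \<beta> g < top"
      by (auto simp: lz_space_def)
    then have "ennreal C * lz_norm \<Omega> a r \<beta> g < top"
      by (simp add: ennreal_mult_less_top)
    then have "interp r g < top"
      using 1[OF g(1)] by (rule order.strict_trans1[rotated])
    then show "g \<in> interp_space \<Omega> (small_leb \<Omega> p \<alpha>) (small_leb_norm \<Omega> p \<alpha>)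
            (small_leb \<Omega> q \<alpha>) (small_leb_norm \<Omega> q \<alpha>) \<theta> r"
      using r by (auto simp: interp_space_def intro: interp_less_top_imp_sum_space)
  qed
  show "\<exists>C>0. \<forall>g \<in> lz_space \<Omega> a r \<beta>.
       interp r g \<le> ennreal C * lz_norm \<Omega> a r \<beta> g \<and> lz_norm \<Omega> a r \<beta> g \<le> ennreal C * interp r g"
    using C 1 2 by (intro exI[of _ C]) (auto simp: lz_space_def)
qed

end

theorem theorem3p4:
  fixes \<Omega> :: "'a::euclidean_space set"
    and \<theta> r p q \<alpha> p\<theta> p\<theta>' :: real
  assumes "open \<Omega>" "bounded \<Omega>" "emeasure lebesgue \<Omega> = 1"
    and "0 < \<theta>" "\<theta> < 1" "1 < r" "1 < p" "p < q" "\<alpha> > 0"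
    and "1 / p\<theta> = (1 - \<theta>) / p + \<theta> / q"
    and "1 / p\<theta> + 1 / p\<theta>' = 1"
  shows "interp_space \<Omega> (small_leb \<Omega> p \<alpha>) (small_leb_norm \<Omega> p \<alpha>)
              (small_leb \<Omega> q \<alpha>) (small_leb_norm \<Omega> q \<alpha>) \<theta> r
           = lz_space \<Omega> p\<theta> r (\<alpha> / p\<theta>')
       \<and> (\<exists>C>0. \<forall>g \<in> lz_space \<Omega> p\<theta> r (\<alpha> / p\<theta>').
             interp_norm \<Omega> (small_leb \<Omega> p \<alpha>) (small_leb_norm \<Omega> p \<alpha>)
                 (small_leb \<Omega> q \<alpha>) (small_leb_norm \<Omega> q \<alpha>) \<theta> r g
               \<le> ennreal C * lz_norm \<Omega> p\<theta> r (\<alpha> / p\<theta>') g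
           \<and> lz_norm \<Omega> p\<theta> r (\<alpha> / p\<theta>') g
               \<le> ennreal C * interp_norm \<Omega> (small_leb \<Omega> p \<alpha>) (small_leb_norm \<Omega> p \<alpha>)
                 (small_leb \<Omega> q \<alpha>) (small_leb_norm \<Omega> q \<alpha>) \<theta> r g)"
proof -
  interpret small_leb_couple \<Omega> p q \<alpha> \<theta>
    using assms by unfold_locales (auto simp: borel_open)
  have a: "1 / p\<theta> = x\<^sub>\<theta>"
    using assms by (simp add: x\<^sub>\<theta>_def)
  have "1 / p\<theta>' = 1 - x\<^sub>\<theta>"
    using a assms by simp
  then have "\<alpha> / p\<theta>' = \<alpha> * (1 - x\<^sub>\<theta>)"
    by (metis times_divide_eq_right mult.right_neutral)
  then show ?thesis
    using interp_space_eq_lz_space[OF \<open>1 < r\<close> a] by blast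
qed

end
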